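(* For every $\boldsymbol v=(v,\boldsymbol\tau)\in V$, $$\|\boldsymbol v\|_{V,\mathrm{opt}}\le C_U\|\boldsymbol v\|_V,\qquad C_U:=\sqrt{3+2\|\mathbf a\|^2_{L^\infty(\Omega)}}.$$
   Context: Let $\Omega\subset\mathbb{R}^d$ be a bounded polyhedral domain with $\partial\Omega=\overline{\Gamma}_D\cup\overline{\Gamma}_N$, $\Gamma_D,\Gamma_N$ disjoint relatively open subsets of $\partial\Omega$. Let $\varepsilon>0$ and $\mathbf a\in[C(\overline\Omega)]^d$. Let $\mathcal{T}$ be a triangulation of $\Omega$ into open elements $K$ with outward unit normals $\boldsymbol n_K$; $\Gamma$ is the mesh skeleton. $\|\cdot\|$ is the broken $L^2$ norm $\|w\|^2=\sum_K\int_K|w|^2dx$. $H^1(\Omega;\mathcal{T})=\{v:v|_K\in H^1(K)\ \forall K\}$, $H(\mathrm{div},\Omega;\mathcal{T})=\{\boldsymbol\tau:\boldsymbol\tau|_K\in H(\mathrm{div},K)\ \forall K\}$; $\nabla$ and $\nabla\cdot$ act elementwise. $V:=H^1(\Omega;\mathcal{T})\times H(\mathrm{div},\Omega;\mathcal{T})$. $H^1_D(\Omega)=\{w\in H^1(\Omega):w=0\text{ on }\Gamma_D\}$, $H_N(\mathrm{div},\Omega)=\{\boldsymbol w\in H(\mathrm{div},\Omega):\boldsymbol w\cdot\boldsymbol n=0\text{ on }\Gamma_N\}$. $\varepsilon$-scaled norms: $\|w\|_{H^1_\varepsilon}:=(\varepsilon^{-1}\|w\|^2+\varepsilon\|\nabla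 w\|^2)^{1/2}$, $\|\boldsymbol w\|_{H_\varepsilon(\mathrm{div})}:=(\varepsilon^{-1}\|\boldsymbol w\|^2+\varepsilon^{-1}\|\nabla\cdot\boldsymbol w\|^2)^{1/2}$. Jump norms: for $v\in H^1(\Omega;\mathcal T)$ and $\boldsymbol\tau\in H(\mathrm{div},\Omega;\mathcal T)$, $$\|[\![v]\!]\|_\Gamma:=\sup_{0\ne\boldsymbol w\in H_N(\mathrm{div},\Omega)}\frac{\sum_K\langle\boldsymbol w\cdot\boldsymbol n_K,v\rangle_{\partial K}}{\|\boldsymbol w\|_{H_\varepsilon(\mathrm{div})}},\qquad \|[\![\boldsymbol\tau]\!]\|_\Gamma:=\sup_{0\ne w\in H^1_D(\Omega)}\frac{\sum_K\langle\boldsymbol\tau\cdot\boldsymbol n_K,w\rangle_{\partial K}}{\|w\|_{H^1_\varepsilon}},$$ with $\langle\cdot,\cdot\rangle_{\partial K}$ the duality pairing on $\partial K$. Test norms on $V$, for $\boldsymbol v=(v,\boldsymbol\tau)$: $$\|\boldsymbol v\|_V^2:=\varepsilon\|\nabla\cdot\boldsymbol\tau-\mathbf a\cdot\nabla v\|^2+\varepsilon^{-1}\|\boldsymbol\tau+\varepsilon\nabla v\|^2+\varepsilon\|v\|^2+\varepsilon\|\nabla v\|^2,$$ $$\|\boldsymbol v\|_{V,\mathrm{opt}}^2:=\varepsilon\|\nabla\cdot\boldsymbol\tau-\mathbf a\cdot\nabla v\|^2+\varepsilon^{-1}\|\boldsymbol\tau+\varepsilon\nabla v\|^2+\|[\![v]\!]\|_\Gamma^2+\|[\![\boldsymbol\tau]\!]\|_\Gamma^2.$$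 *)

theory Defs
  imports "HOL-Analysis.Analysis"
begin

definition polyhedral_domain :: "'a::euclidean_space set \<Rightarrow> bool" where
  "polyhedral_domain \<Omega> \<longleftrightarrow> open \<Omega> \<and> connected \<Omega> \<and> bounded \<Omega> \<and> \<Omega> \<noteq> {} \<and>
     interior (closure \<Omega>) = \<Omega> \<and>
     (\<exists>P. finite P \<and> (\<forall>p\<in>P. polytope p) \<and> closure \<Omega> = \<Union>P)"

definition boundary_partition :: "'a::euclidean_space set \<Rightarrow> 'a set \<Rightarrow> 'a set \<Rightarrow> bool" where
  "boundary_partition \<Omega> GD GN \<longleftrightarrow>
     openin (top_of_set (frontier \<Omega>)) GD \<and> openin (top_of_set (frontier \<Omega>)) GN \<and>
     GD \<inter> GN = {} \<and> frontier \<Omega> = closure GD \<union> closure GN"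

definition open_simplex :: "'a set \<Rightarrow> 'a::euclidean_space set \<Rightarrow> bool" where
  "open_simplex S K \<longleftrightarrow> finite S \<and> card S = DIM('a) + 1 \<and> \<not> affine_dependent S \<and>
     K = interior (convex hull S)"

definition triangulation :: "'a::euclidean_space set set \<Rightarrow> 'a set \<Rightarrow> bool" where
  "triangulation T \<Omega> \<longleftrightarrow> finite T \<and> (\<forall>K\<in>T. \<exists>S. open_simplex S K) \<and> (\<forall>K\<in>T. K \<subseteq> \<Omega>) \<and>
     pairwise disjnt T \<and> \<Union>(closure ` T) = closure \<Omega> \<and>
     (\<forall>K1\<in>T. \<forall>K2\<in>T. \<forall>S1 S2. open_simplex S1 K1 \<and> open_simplex S2 K2 \<longrightarrow>
        closure K1 \<inter> closure K2 = convex hull (S1 \<inter> S2))"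

definition tsupp :: "('a::topological_space \<Rightarrow> 'b::zero) \<Rightarrow> 'a set" where
  "tsupp f = closure {x. f x \<noteq> 0}"

definition C1c_on :: "'a set \<Rightarrow> ('a::euclidean_space \<Rightarrow> 'b::euclidean_space) \<Rightarrow> bool" where
  "C1c_on U f \<longleftrightarrow> (\<exists>D. (\<forall>x. (f has_derivative D x) (at x)) \<and> (\<forall>h. continuous_on UNIV (\<lambda>x. D x h)))
     \<and> compact (tsupp f) \<and> tsupp f \<subseteq> U"

definition cgrad :: "('a::euclidean_space \<Rightarrow> real) \<Rightarrow> 'a \<Rightarrow> 'a" where
  "cgrad f x = (\<Sum>b\<in>Basis. frechet_derivative f (at x) b *\<^sub>R b)"

definition cdiv :: "('a::euclidean_space \<Rightarrow> 'a) \<Rightarrow> 'a \<Rightarrow> real" where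
  "cdiv f x = (\<Sum>b\<in>Basis. frechet_derivative f (at x) b \<bullet> b)"

definition L2 :: "'a::euclidean_space set \<Rightarrow> ('a \<Rightarrow> real) \<Rightarrow> bool" where
  "L2 K f \<longleftrightarrow> set_borel_measurable lebesgue K f \<and> set_integrable lebesgue K (\<lambda>x. (f x)^2)"

definition L2v :: "'a::euclidean_space set \<Rightarrow> ('a \<Rightarrow> 'a) \<Rightarrow> bool" where
  "L2v K f \<longleftrightarrow> set_borel_measurable lebesgue K f \<and> set_integrable lebesgue K (\<lambda>x. (norm (f x))^2)"

definition weak_grad :: "'a::euclidean_space set \<Rightarrow> ('a \<Rightarrow> real) \<Rightarrow> ('a \<Rightarrow> 'a) \<Rightarrow> bool" where
  "weak_grad K v g \<longleftrightarrow> (\<forall>\<psi>::'a \<Rightarrow> 'a. C1c_on K \<psi> \<longrightarrow>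
     (LINT x:K|lebesgue. v x * cdiv \<psi> x) = - (LINT x:K|lebesgue. g x \<bullet> \<psi> x))"

definition weak_div :: "'a::euclidean_space set \<Rightarrow> ('a \<Rightarrow> 'a) \<Rightarrow> ('a \<Rightarrow> real) \<Rightarrow> bool" where
  "weak_div K w d \<longleftrightarrow> (\<forall>\<phi>::'a \<Rightarrow> real. C1c_on K \<phi> \<longrightarrow>
     (LINT x:K|lebesgue. w x \<bullet> cgrad \<phi> x) = - (LINT x:K|lebesgue. d x * \<phi> x))"

definition H1 :: "'a::euclidean_space set \<Rightarrow> ('a \<Rightarrow> real) \<Rightarrow> bool" where
  "H1 K v \<longleftrightarrow> L2 K v \<and> (\<exists>g. L2v K g \<and> weak_grad K v g)"

definition Hdiv :: "'a::euclidean_space set \<Rightarrow> ('a \<Rightarrow> 'a) \<Rightarrow> bool" where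
  "Hdiv K w \<longleftrightarrow> L2v K w \<and> (\<exists>d. L2 K d \<and> weak_div K w d)"

text \<open>The (a.e. unique) weak gradient / divergence on K.\<close>
definition wgrad :: "'a::euclidean_space set \<Rightarrow> ('a \<Rightarrow> real) \<Rightarrow> 'a \<Rightarrow> 'a" where
  "wgrad K v = (SOME g. L2v K g \<and> weak_grad K v g)"

definition wdiv :: "'a::euclidean_space set \<Rightarrow> ('a \<Rightarrow> 'a) \<Rightarrow> 'a \<Rightarrow> real" where
  "wdiv K w = (SOME d. L2 K d \<and> weak_div K w d)"

definition broken_H1 :: "'a::euclidean_space set set \<Rightarrow> ('a \<Rightarrow> real) \<Rightarrow> bool" where
  "broken_H1 T v \<longleftrightarrow> (\<forall>K\<in>T. H1 K v)"

definition broken_Hdiv :: "'a::euclidean_space set set \<Rightarrow> ('a \<Rightarrow> 'a) \<Rightarrow> bool" where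
  "broken_Hdiv T w \<longleftrightarrow> (\<forall>K\<in>T. Hdiv K w)"

text \<open>H^1_D(Omega): zero trace on Gamma_D, expressed weakly via Green's formula
  against smooth vector fields whose support meets the boundary only inside Gamma_D.\<close>
definition H1_D :: "'a::euclidean_space set \<Rightarrow> 'a set \<Rightarrow> ('a \<Rightarrow> real) set" where
  "H1_D \<Omega> GD = {w. H1 \<Omega> w \<and> (\<forall>\<psi>::'a \<Rightarrow> 'a. C1c_on UNIV \<psi> \<and> tsupp \<psi> \<inter> frontier \<Omega> \<subseteq> GD \<longrightarrow>
      (LINT x:\<Omega>|lebesgue. w x * cdiv \<psi> x + wgrad \<Omega> w x \<bullet> \<psi> x) = 0)}"

text \<open>H_N(div,Omega): zero normal trace on Gamma_N, expressed weakly via Green's formula.\<close>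
definition Hdiv_N :: "'a::euclidean_space set \<Rightarrow> 'a set \<Rightarrow> ('a \<Rightarrow> 'a) set" where
  "Hdiv_N \<Omega> GN = {w. Hdiv \<Omega> w \<and> (\<forall>\<phi>::'a \<Rightarrow> real. C1c_on UNIV \<phi> \<and> tsupp \<phi> \<inter> frontier \<Omega> \<subseteq> GN \<longrightarrow>
      (LINT x:\<Omega>|lebesgue. w x \<bullet> cgrad \<phi> x + wdiv \<Omega> w x * \<phi> x) = 0)}"

text \<open>Duality pairing <tau . n_K, v>_{dK}, defined by the generalized Green formula on K.\<close>
definition bpair :: "'a::euclidean_space set \<Rightarrow> ('a \<Rightarrow> 'a) \<Rightarrow> ('a \<Rightarrow> real) \<Rightarrow> real" where
  "bpair K w v = (LINT x:K|lebesgue. wdiv K w x * v x + w x \<bullet> wgrad K v x)"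

definition H1_eps_norm :: "'a::euclidean_space set set \<Rightarrow> real \<Rightarrow> ('a \<Rightarrow> real) \<Rightarrow> real" where
  "H1_eps_norm T \<epsilon> w = sqrt (inverse \<epsilon> * (\<Sum>K\<in>T. LINT x:K|lebesgue. (w x)^2)
                         + \<epsilon> * (\<Sum>K\<in>T. LINT x:K|lebesgue. (norm (wgrad K w x))^2))"

definition Hdiv_eps_norm :: "'a::euclidean_space set set \<Rightarrow> real \<Rightarrow> ('a \<Rightarrow> 'a) \<Rightarrow> real" where
  "Hdiv_eps_norm T \<epsilon> w = sqrt (inverse \<epsilon> * (\<Sum>K\<in>T. LINT x:K|lebesgue. (norm (w x))^2)
                         + inverse \<epsilon> * (\<Sum>K\<in>T. LINT x:K|lebesgue. (wdiv K w x)^2))"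

definition jump_norm_v :: "'a::euclidean_space set set \<Rightarrow> 'a set \<Rightarrow> 'a set \<Rightarrow> real \<Rightarrow> ('a \<Rightarrow> real) \<Rightarrow> real" where
  "jump_norm_v T \<Omega> GN \<epsilon> v = Sup {(\<Sum>K\<in>T. bpair K w v) / Hdiv_eps_norm T \<epsilon> w | w.
       w \<in> Hdiv_N \<Omega> GN \<and> Hdiv_eps_norm T \<epsilon> w \<noteq> 0}"

definition jump_norm_tau :: "'a::euclidean_space set set \<Rightarrow> 'a set \<Rightarrow> 'a set \<Rightarrow> real \<Rightarrow> ('a \<Rightarrow> 'a) \<Rightarrow> real" where
  "jump_norm_tau T \<Omega> GD \<epsilon> \<tau> = Sup {(\<Sum>K\<in>T. bpair K \<tau> w) / H1_eps_norm T \<epsilon> w | w.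
       w \<in> H1_D \<Omega> GD \<and> H1_eps_norm T \<epsilon> w \<noteq> 0}"

definition V_norm :: "'a::euclidean_space set set \<Rightarrow> real \<Rightarrow> ('a \<Rightarrow> 'a) \<Rightarrow> ('a \<Rightarrow> real) \<Rightarrow> ('a \<Rightarrow> 'a) \<Rightarrow> real" where
  "V_norm T \<epsilon> a v \<tau> = sqrt (
       \<epsilon> * (\<Sum>K\<in>T. LINT x:K|lebesgue. (wdiv K \<tau> x - a x \<bullet> wgrad K v x)^2)
     + inverse \<epsilon> * (\<Sum>K\<in>T. LINT x:K|lebesgue. (norm (\<tau> x + \<epsilon> *\<^sub>R wgrad K v x))^2)
     + \<epsilon> * (\<Sum>K\<in>T. LINT x:K|lebesgue. (v x)^2)
     + \<epsilon> * (\<Sum>K\<in>T. LINT x:K|lebesgue. (norm (wgrad K v x))^2))"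

definition V_opt_norm :: "'a::euclidean_space set set \<Rightarrow> 'a set \<Rightarrow> 'a set \<Rightarrow> 'a set \<Rightarrow> real \<Rightarrow>
     ('a \<Rightarrow> 'a) \<Rightarrow> ('a \<Rightarrow> real) \<Rightarrow> ('a \<Rightarrow> 'a) \<Rightarrow> real" where
  "V_opt_norm T \<Omega> GD GN \<epsilon> a v \<tau> = sqrt (
       \<epsilon> * (\<Sum>K\<in>T. LINT x:K|lebesgue. (wdiv K \<tau> x - a x \<bullet> wgrad K v x)^2)
     + inverse \<epsilon> * (\<Sum>K\<in>T. LINT x:K|lebesgue. (norm (\<tau> x + \<epsilon> *\<^sub>R wgrad K v x))^2)
     + (jump_norm_v T \<Omega> GN \<epsilon> v)^2 + (jump_norm_tau T \<Omega> GD \<epsilon> \<tau>)^2)"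

text \<open>L-infinity norm of a continuous vector field (pointwise Euclidean norm).\<close>
definition Linf_norm :: "'a::euclidean_space set \<Rightarrow> ('a \<Rightarrow> 'a) \<Rightarrow> real" where
  "Linf_norm \<Omega> a = (SUP x\<in>\<Omega>. norm (a x))"

end

(*
On each element the duality pairing is an L2 pairing of (div w, w) with (v, grad v), so a weighted
Cauchy-Schwarz inequality bounds |[v]|^2 by eps ||v||^2 + eps ||grad v||^2 and |[tau]|^2 by
eps ||div tau||^2 + eps^-1 ||tau||^2.  In the latter,
div tau = (div tau - a . grad v) + a . grad v and tau = (tau + eps grad v) - eps grad v.

Sup {} is an unspecified real, so the jump norms are only controlled once H1_D and Hdiv_N are known
to contain functions of nonzero norm.  Bump functions inside an element serve as witnesses; checking
their membership needs Green's formula for C1 functions and the weak uniqueness of the chosen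
gradient and divergence.
*)
theory Submission
  imports Defs
begin

text \<open>What shapes the proof is that \<open>wgrad\<close> and \<open>wdiv\<close> are choices,
  made separately on \<Omega> and on every element. \<open>bpair\<close> and the scaled norms use
  the same elementwise choices, so the upper bounds never compare two of them; it is enough that the
  functions in the suprema restrict to each element. The witnesses are harder: the boundary
  conditions in \<open>H1_D\<close> and \<open>Hdiv_N\<close> involve the choice on \<Omega>, tested
  with functions that may reach the boundary, whereas a weak derivative is tested only with compact
  supports inside. Cutoffs and dominated convergence close this gap. The constant is the coefficient
  of eps ||grad v||^2. Splitting div tau and tau into two parts each costs a factor 2, so this term
  receives 1 from the jump of v, 2 ||a||^2 from div tau, and 2 from tau, where eps^-1 eps^2 =
  eps.\<close>

section \<open>Square-integrable functions on a set\<close>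

text \<open>Common form of \<open>L2\<close> and \<open>L2v\<close>, polymorphic in the codomain, so
  that the closure properties are proved once for scalars and vectors.\<close>

definition sq_int :: "'a::euclidean_space set \<Rightarrow> ('a \<Rightarrow> 'b::euclidean_space) \<Rightarrow> bool" where
  "sq_int K f \<longleftrightarrow> set_borel_measurable lebesgue K f \<and> set_integrable lebesgue K (\<lambda>x. (norm (f x))\<^sup>2)"

lemma L2_iff_sq_int: "L2 K f \<longleftrightarrow> sq_int K f"
  by (simp add: L2_def sq_int_def)

lemma L2v_iff_sq_int: "L2v K f \<longleftrightarrow> sq_int K f"
  by (simp add: L2v_def sq_int_def)

lemma sq_int_measurable: "sq_int K f \<Longrightarrow> set_borel_measurable lebesgue K f"
  by (simp add: sq_int_def)

lemma sq_int_norm: "sq_int K f \<Longrightarrow> set_integrable lebesgue K (\<lambda>x. (norm (f x))\<^sup>2)"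
  by (simp add: sq_int_def)

lemma sq_int_real: "sq_int K f \<Longrightarrow> set_integrable lebesgue K (\<lambda>x. (f x :: real)\<^sup>2)"
  by (simp add: sq_int_def)

text \<open>The sum of the two squared norms dominates the product. Measurability is known only
  after multiplication by the indicator of \<open>K\<close>, so the idempotent indicator is
  duplicated onto both factors.\<close>

lemma sq_int_inner:
  assumes "sq_int K f" "sq_int K g"
  shows "set_integrable lebesgue K (\<lambda>x. f x \<bullet> g x)"
proof -
  have m: "(\<lambda>x. indicator K x *\<^sub>R f x) \<in> borel_measurable lebesgue"
          "(\<lambda>x. indicator K x *\<^sub>R g x) \<in> borel_measurable lebesgue"
    using assms by (auto simp: sq_int_def set_borel_measurable_def)
  have eq: "indicator K x *\<^sub>R (f x \<bullet> g x) = (indicator K x *\<^sub>R f x) \<bullet> (indicator K x *\<^sub>R g x)" for x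
    by (auto simp: indicator_def)
  have "set_integrable lebesgue K (\<lambda>x. (norm (f x))\<^sup>2 + (norm (g x))\<^sup>2)"
    using assms by (intro set_integral_add) (auto simp: sq_int_def)
  then show ?thesis
  proof (rule set_integrable_bound)
    show "set_borel_measurable lebesgue K (\<lambda>x. f x \<bullet> g x)"
      unfolding set_borel_measurable_def eq using m by measurable
    have "norm (f x \<bullet> g x) \<le> norm ((norm (f x))\<^sup>2 + (norm (g x))\<^sup>2)" for x
    proof -
      have "\<bar>f x \<bullet> g x\<bar> \<le> norm (f x) * norm (g x)" by (rule Cauchy_Schwarz_ineq2)
      also have "\<dots> \<le> 2 * (norm (f x) * norm (g x))" by simp
      also have "\<dots> \<le> (norm (f x))\<^sup>2 + (norm (g x))\<^sup>2"
        using sum_squares_bound[of "norm (f x)" "norm (g x)"] by simp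
      finally show ?thesis by simp
    qed
    then show "AE x in lebesgue. x \<in> K \<longrightarrow> norm (f x \<bullet> g x) \<le> norm ((norm (f x))\<^sup>2 + (norm (g x))\<^sup>2)"
      by simp
  qed
qed

lemma sq_int_mult: "sq_int K f \<Longrightarrow> sq_int K g \<Longrightarrow> set_integrable lebesgue K (\<lambda>x. f x * g x :: real)"
  using sq_int_inner[of K f g] by simp

lemma sq_int_add:
  fixes f g :: "'a::euclidean_space \<Rightarrow> 'b::euclidean_space"
  assumes "sq_int K f" "sq_int K g"
  shows "sq_int K (\<lambda>x. f x + g x)"
proof -
  have m: "set_borel_measurable lebesgue K (\<lambda>x. f x + g x)"
    using assms by (auto simp: sq_int_def set_borel_measurable_def scaleR_add_right)
  have "set_integrable lebesgue K (\<lambda>x. f x \<bullet> f x + 2 * (f x \<bullet> g x) + g x \<bullet> g x)"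
    by (intro set_integral_add set_integrable_mult_right sq_int_inner assms)
  also have "(\<lambda>x. f x \<bullet> f x + 2 * (f x \<bullet> g x) + g x \<bullet> g x) = (\<lambda>x. (norm (f x + g x))\<^sup>2)"
    by (auto simp: power2_norm_eq_inner inner_add inner_commute)
  finally show ?thesis using m by (simp add: sq_int_def)
qed

lemma sq_int_scaleR:
  assumes "sq_int K f" shows "sq_int K (\<lambda>x. c *\<^sub>R f x)"
proof -
  have "set_borel_measurable lebesgue K (\<lambda>x. c *\<^sub>R f x)"
  proof -
    have eq: "indicator K x *\<^sub>R c *\<^sub>R f x = c *\<^sub>R indicator K x *\<^sub>R f x" for x
      by simp
    show ?thesis unfolding set_borel_measurable_def eq
      using sq_int_measurable[OF assms] unfolding set_borel_measurable_def
      by (rule borel_measurable_scaleR[OF borel_measurable_const])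
  qed
  then show ?thesis using assms
    by (simp add: sq_int_def power_mult_distrib)
qed

lemma sq_int_diff:
  assumes "sq_int K f" "sq_int K g" shows "sq_int K (\<lambda>x. f x - g x)"
  using sq_int_add[OF assms(1) sq_int_scaleR[OF assms(2), of "-1"]] by simp

text \<open>Meant for the advection term: a bounded field times a square-integrable gradient is
  dominated by \<open>M\<close> times the norm of the gradient.\<close>

lemma sq_int_inner_bounded:
  assumes "set_borel_measurable lebesgue K a" "sq_int K g" "\<And>x. x \<in> K \<Longrightarrow> norm (a x) \<le> M"
  shows "sq_int K (\<lambda>x. a x \<bullet> g x)"
proof -
  have eq: "indicator K x *\<^sub>R (a x \<bullet> g x) = (indicator K x *\<^sub>R a x) \<bullet> (indicator K x *\<^sub>R g x)" for x
    by (auto simp: indicator_def)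
  have m: "set_borel_measurable lebesgue K (\<lambda>x. a x \<bullet> g x)"
    using assms(1) sq_int_measurable[OF assms(2)] unfolding set_borel_measurable_def eq
    by (rule borel_measurable_inner)
  have eq2: "indicator K x *\<^sub>R (norm (a x \<bullet> g x))\<^sup>2 = (indicator K x *\<^sub>R (a x \<bullet> g x))\<^sup>2" for x
    by (auto simp: indicator_def)
  have "set_integrable lebesgue K (\<lambda>x. M\<^sup>2 * (norm (g x))\<^sup>2)"
    using assms by (simp add: sq_int_def)
  then have "set_integrable lebesgue K (\<lambda>x. (norm (a x \<bullet> g x))\<^sup>2)"
  proof (rule set_integrable_bound)
    show "set_borel_measurable lebesgue K (\<lambda>x. (norm (a x \<bullet> g x))\<^sup>2)"
      unfolding set_borel_measurable_def eq2 using m unfolding set_borel_measurable_def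
      by measurable
    have "norm ((norm (a x \<bullet> g x))\<^sup>2) \<le> norm (M\<^sup>2 * (norm (g x))\<^sup>2)" if "x \<in> K" for x
    proof -
      have "\<bar>a x \<bullet> g x\<bar> \<le> norm (a x) * norm (g x)" by (rule Cauchy_Schwarz_ineq2)
      also have "\<dots> \<le> M * norm (g x)" by (intro mult_right_mono assms that) auto
      finally have "\<bar>a x \<bullet> g x\<bar>\<^sup>2 \<le> (M * norm (g x))\<^sup>2" by (rule power_mono) auto
      then show ?thesis by (simp add: power_mult_distrib)
    qed
    then show "AE x in lebesgue. x \<in> K \<longrightarrow> norm ((norm (a x \<bullet> g x))\<^sup>2) \<le> norm (M\<^sup>2 * (norm (g x))\<^sup>2)"
      by simp
  qed
  with m show ?thesis by (simp add: sq_int_def)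
qed

lemma set_borel_measurable_subset_lebesgue:
  fixes f :: "'a::euclidean_space \<Rightarrow> 'b::euclidean_space"
  assumes "set_borel_measurable lebesgue \<Omega> f" "K \<in> sets lebesgue" "K \<subseteq> \<Omega>"
  shows "set_borel_measurable lebesgue K f"
proof -
  have eq: "indicat_real K x *\<^sub>R f x = indicat_real K x *\<^sub>R (indicat_real \<Omega> x *\<^sub>R f x)" for x
    using assms by (auto simp: indicator_def)
  show ?thesis using assms(1) unfolding set_borel_measurable_def
    by (subst eq) (rule borel_measurable_scaleR[OF borel_measurable_indicator[OF assms(2)]])
qed

lemma sq_int_subset:
  assumes "sq_int \<Omega> f" "K \<in> sets lebesgue" "K \<subseteq> \<Omega>"
  shows "sq_int K f"
  using assms set_borel_measurable_subset_lebesgue[of \<Omega> f K] set_integrable_subset[of lebesgue \<Omega> _ K]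
  by (auto simp: sq_int_def)

section \<open>Weighted Cauchy-Schwarz inequality for the broken pairing\<close>

lemma set_lebesgue_integral_nonneg:
  "(\<And>x. x \<in> A \<Longrightarrow> 0 \<le> f x) \<Longrightarrow> 0 \<le> (LINT x:A|M. f x :: real)"
  unfolding set_lebesgue_integral_def
  by (rule Bochner_Integration.integral_nonneg) (auto simp: indicator_def)

text \<open>The right-hand side of the hypothesis is least at t = Y / X, with value 2 X Y. Since
  \<open>X\<close> or \<open>Y\<close> may vanish, both are first enlarged by a small
  \<open>d\<close>, which is absorbed in an arbitrary error.\<close>

lemma le_mult_of_weighted:
  fixes P X Y :: real
  assumes "X \<ge> 0" "Y \<ge> 0" and le: "\<And>t. t > 0 \<Longrightarrow> 2 * P \<le> t * X\<^sup>2 + Y\<^sup>2 / t"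
  shows "P \<le> X * Y"
proof (rule field_le_epsilon)
  fix e :: real assume "e > 0"
  \<comment> \<open>The error will be d (X + Y + d); the cap at 1 bounds it by d (X + Y + 1), and
    the second bound makes that at most \<open>e\<close>.\<close>
  define d where "d = min 1 (e / (X + Y + 1))"
  have "X + Y + 1 > 0" using assms by simp
  have d: "d > 0" "d \<le> 1"
    using \<open>e > 0\<close> assms by (auto simp: d_def)
  have "d \<le> e / (X + Y + 1)" by (simp add: d_def)
  then have de: "d * (X + Y + 1) \<le> e"
    using \<open>X + Y + 1 > 0\<close> by (simp only: pos_le_divide_eq)
  \<comment> \<open>The minimiser for the enlarged values, well defined and positive even if
    \<open>X\<close> or \<open>Y\<close> is 0.\<close>
  define t where "t = (Y + d) / (X + d)"
  have t: "t > 0" using d assms by (simp add: t_def)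
  have "X\<^sup>2 \<le> (X + d)\<^sup>2" "Y\<^sup>2 \<le> (Y + d)\<^sup>2" using d assms by (auto intro!: power_mono)
  then have "2 * P \<le> t * (X + d)\<^sup>2 + (Y + d)\<^sup>2 / t"
    using le[OF t] t mult_left_mono[of "X\<^sup>2" "(X + d)\<^sup>2" t] divide_right_mono[of "Y\<^sup>2" "(Y + d)\<^sup>2" t]
    by linarith
  also have "\<dots> = 2 * ((X + d) * (Y + d))"
    using d assms by (simp add: t_def power2_eq_square)
  finally have "P \<le> X * Y + d * (X + Y + d)" by (simp add: algebra_simps)
  also have "d * (X + Y + d) \<le> d * (X + Y + 1)" using d by (intro mult_left_mono) auto
  finally show "P \<le> X * Y + e" using de by linarith
qed

text \<open>Young's inequality is applied pointwise with one parameter \<open>t\<close> for all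
  elements and both products, then integrated and summed; \<open>le_mult_of_weighted\<close>
  optimises \<open>t\<close> once at the end. This does the work of Cauchy-Schwarz for the
  integrals, for the two products and for the sum over the mesh at the same time.\<close>

lemma broken_pairing_le:
  fixes p q :: "'a::euclidean_space set \<Rightarrow> 'a \<Rightarrow> real" and r s :: "'a set \<Rightarrow> 'a \<Rightarrow> 'a"
  assumes pos: "\<alpha> > 0" "\<beta> > 0"
    and L: "\<And>K. K \<in> T \<Longrightarrow> sq_int K (p K)" "\<And>K. K \<in> T \<Longrightarrow> sq_int K (q K)"
           "\<And>K. K \<in> T \<Longrightarrow> sq_int K (r K)" "\<And>K. K \<in> T \<Longrightarrow> sq_int K (s K)"
  shows "(\<Sum>K\<in>T. LINT x:K|lebesgue. p K x * q K x + r K x \<bullet> s K x)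
     \<le> sqrt (\<alpha> * (\<Sum>K\<in>T. LINT x:K|lebesgue. (p K x)\<^sup>2) + \<beta> * (\<Sum>K\<in>T. LINT x:K|lebesgue. (norm (r K x))\<^sup>2))
      * sqrt (inverse \<alpha> * (\<Sum>K\<in>T. LINT x:K|lebesgue. (q K x)\<^sup>2) + inverse \<beta> * (\<Sum>K\<in>T. LINT x:K|lebesgue. (norm (s K x))\<^sup>2))"
    (is "?P \<le> sqrt ?X * sqrt ?Y")
proof (rule le_mult_of_weighted)
  have X0: "?X \<ge> 0" and Y0: "?Y \<ge> 0"
    using pos by (auto intro!: add_nonneg_nonneg mult_nonneg_nonneg sum_nonneg set_lebesgue_integral_nonneg)
  then show "sqrt ?X \<ge> 0" "sqrt ?Y \<ge> 0" by auto
  fix t :: real assume t: "t > 0"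
  have pt: "2 * (a * b) \<le> c * a\<^sup>2 + b\<^sup>2 / c" if "c > 0" for a b c :: real
  proof -
    have "0 \<le> (c * a - b)\<^sup>2 / c" using that by simp
    also have "\<dots> = c * a\<^sup>2 + b\<^sup>2 / c - 2 * (a * b)"
      using that by (simp add: power2_eq_square field_simps)
    finally show ?thesis by simp
  qed
  have one: "2 * (LINT x:K|lebesgue. p K x * q K x + r K x \<bullet> s K x)
      \<le> t * (\<alpha> * (LINT x:K|lebesgue. (p K x)\<^sup>2) + \<beta> * (LINT x:K|lebesgue. (norm (r K x))\<^sup>2))
       + (inverse \<alpha> * (LINT x:K|lebesgue. (q K x)\<^sup>2) + inverse \<beta> * (LINT x:K|lebesgue. (norm (s K x))\<^sup>2)) / t"
    (is "_ \<le> ?R") if K: "K \<in> T" for K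
  proof -
    note I = sq_int_real[OF L(1)[OF K]] sq_int_real[OF L(2)[OF K]] sq_int_norm[OF L(3)[OF K]] sq_int_norm[OF L(4)[OF K]]
      sq_int_mult[OF L(1,2)[OF K]] sq_int_inner[OF L(3,4)[OF K]]
    have "2 * (LINT x:K|lebesgue. p K x * q K x + r K x \<bullet> s K x)
        = (LINT x:K|lebesgue. 2 * (p K x * q K x + r K x \<bullet> s K x))"
      by (rule set_integral_mult_right[symmetric])
    also have "\<dots> \<le> (LINT x:K|lebesgue. (t * \<alpha> * (p K x)\<^sup>2 + t * \<beta> * (norm (r K x))\<^sup>2)
        + (1 / (t * \<alpha>) * (q K x)\<^sup>2 + 1 / (t * \<beta>) * (norm (s K x))\<^sup>2))"
    proof (rule set_integral_mono)
      show "set_integrable lebesgue K (\<lambda>x. 2 * (p K x * q K x + r K x \<bullet> s K x))"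
        by (intro set_integrable_mult_right set_integral_add I)
      show "set_integrable lebesgue K (\<lambda>x. (t * \<alpha> * (p K x)\<^sup>2 + t * \<beta> * (norm (r K x))\<^sup>2)
        + (1 / (t * \<alpha>) * (q K x)\<^sup>2 + 1 / (t * \<beta>) * (norm (s K x))\<^sup>2))"
        by (intro set_integrable_mult_right set_integral_add I)
      fix x
      have "r K x \<bullet> s K x \<le> norm (r K x) * norm (s K x)" by (rule norm_cauchy_schwarz)
      then show "2 * (p K x * q K x + r K x \<bullet> s K x) \<le> (t * \<alpha> * (p K x)\<^sup>2 + t * \<beta> * (norm (r K x))\<^sup>2)
        + (1 / (t * \<alpha>) * (q K x)\<^sup>2 + 1 / (t * \<beta>) * (norm (s K x))\<^sup>2)"
        using pt[of "t * \<alpha>" "p K x" "q K x"] pt[of "t * \<beta>" "norm (r K x)" "norm (s K x)"] t pos by simp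
    qed
    also have "\<dots> = (t * \<alpha> * (LINT x:K|lebesgue. (p K x)\<^sup>2) + t * \<beta> * (LINT x:K|lebesgue. (norm (r K x))\<^sup>2))
        + (1 / (t * \<alpha>) * (LINT x:K|lebesgue. (q K x)\<^sup>2) + 1 / (t * \<beta>) * (LINT x:K|lebesgue. (norm (s K x))\<^sup>2))"
      by (simp only: set_integral_add(2) set_integral_add(1) set_integrable_mult_right I set_integral_mult_right)
    also have "\<dots> = ?R" using t pos by (simp add: field_simps)
    finally show ?thesis .
  qed
  have "2 * ?P \<le> (\<Sum>K\<in>T. t * (\<alpha> * (LINT x:K|lebesgue. (p K x)\<^sup>2) + \<beta> * (LINT x:K|lebesgue. (norm (r K x))\<^sup>2))
       + (inverse \<alpha> * (LINT x:K|lebesgue. (q K x)\<^sup>2) + inverse \<beta> * (LINT x:K|lebesgue. (norm (s K x))\<^sup>2)) / t)"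
    unfolding sum_distrib_left by (intro sum_mono one)
  also have "\<dots> = t * ?X + ?Y / t"
    by (simp only: sum.distrib sum_distrib_left[symmetric] sum_divide_distrib[symmetric])
  finally show "2 * ?P \<le> t * (sqrt ?X)\<^sup>2 + (sqrt ?Y)\<^sup>2 / t" using X0 Y0 by simp
qed

text \<open>Changing the signs of \<open>p\<close> and \<open>r\<close> gives the lower bound. Both
  bounds matter because the jump norms enter \<open>V_opt_norm\<close> squared, so their suprema
  must be controlled in absolute value.\<close>

lemma abs_broken_pairing_le:
  fixes p q :: "'a::euclidean_space set \<Rightarrow> 'a \<Rightarrow> real" and r s :: "'a set \<Rightarrow> 'a \<Rightarrow> 'a"
  assumes pos: "\<alpha> > 0" "\<beta> > 0"
    and L: "\<And>K. K \<in> T \<Longrightarrow> sq_int K (p K)" "\<And>K. K \<in> T \<Longrightarrow> sq_int K (q K)"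
           "\<And>K. K \<in> T \<Longrightarrow> sq_int K (r K)" "\<And>K. K \<in> T \<Longrightarrow> sq_int K (s K)"
  shows "\<bar>\<Sum>K\<in>T. LINT x:K|lebesgue. p K x * q K x + r K x \<bullet> s K x\<bar>
     \<le> sqrt (\<alpha> * (\<Sum>K\<in>T. LINT x:K|lebesgue. (p K x)\<^sup>2) + \<beta> * (\<Sum>K\<in>T. LINT x:K|lebesgue. (norm (r K x))\<^sup>2))
      * sqrt (inverse \<alpha> * (\<Sum>K\<in>T. LINT x:K|lebesgue. (q K x)\<^sup>2) + inverse \<beta> * (\<Sum>K\<in>T. LINT x:K|lebesgue. (norm (s K x))\<^sup>2))" (is "_ \<le> ?B")
proof -
  have "sq_int K (\<lambda>x. - p K x)" "sq_int K (\<lambda>x. - r K x)" if "K \<in> T" for K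
    using sq_int_scaleR[OF L(1)[OF that], of "-1"] sq_int_scaleR[OF L(3)[OF that], of "-1"] by auto
  from broken_pairing_le[OF pos this(1) L(2) this(2) L(4)]
  have "(\<Sum>K\<in>T. LINT x:K|lebesgue. - p K x * q K x + - r K x \<bullet> s K x) \<le> ?B" by simp
  also have "(\<lambda>K. LINT x:K|lebesgue. - p K x * q K x + - r K x \<bullet> s K x)
      = (\<lambda>K. - (LINT x:K|lebesgue. p K x * q K x + r K x \<bullet> s K x))"
  proof
    fix K
    have "- p K x * q K x + - r K x \<bullet> s K x = (-1) * (p K x * q K x + r K x \<bullet> s K x)" for x by simp
    then show "(LINT x:K|lebesgue. - p K x * q K x + - r K x \<bullet> s K x)
       = - (LINT x:K|lebesgue. p K x * q K x + r K x \<bullet> s K x)"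
      by (simp only: set_integral_mult_right)
  qed
  finally show ?thesis using broken_pairing_le[OF pos L] unfolding sum_negf abs_le_iff by blast
qed

section \<open>Restriction of weak derivatives and Sobolev functions to an element\<close>

lemma C1c_on_mono: "C1c_on K f \<Longrightarrow> K \<subseteq> \<Omega> \<Longrightarrow> C1c_on \<Omega> f"
  by (auto simp: C1c_on_def)

lemma eq_0_outside_tsupp: "x \<notin> tsupp f \<Longrightarrow> f x = 0"
  using closure_subset[of "{x. f x \<noteq> 0}"] by (auto simp: tsupp_def)

lemma frechet_derivative_outside_tsupp:
  fixes f :: "'a::real_normed_vector \<Rightarrow> 'b::real_normed_vector"
  assumes "x \<notin> tsupp f"
  shows "frechet_derivative f (at x) = (\<lambda>h. 0)"
proof -
  have "open (- tsupp f)" unfolding tsupp_def by (intro open_Compl closed_closure)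
  moreover have "((\<lambda>x. 0) has_derivative (\<lambda>h. 0)) (at x)" by simp
  ultimately have "(f has_derivative (\<lambda>h. 0)) (at x)"
    using assms by (subst has_derivative_transform_within_open[where f="\<lambda>x. 0" and s="- tsupp f"])
       (auto dest: eq_0_outside_tsupp)
  then show ?thesis using frechet_derivative_at by metis
qed

lemma cgrad_outside_tsupp: "x \<notin> tsupp f \<Longrightarrow> cgrad f x = 0"
  by (simp add: cgrad_def frechet_derivative_outside_tsupp)

lemma cdiv_outside_tsupp: "x \<notin> tsupp f \<Longrightarrow> cdiv f x = 0"
  by (simp add: cdiv_def frechet_derivative_outside_tsupp)

lemma set_integral_eq_subset:
  fixes f :: "'a \<Rightarrow> real"
  assumes "K \<subseteq> \<Omega>" "\<And>x. x \<in> \<Omega> \<Longrightarrow> x \<notin> K \<Longrightarrow> f x = 0"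
  shows "(LINT x:K|M. f x) = (LINT x:\<Omega>|M. f x)"
  unfolding set_lebesgue_integral_def
  by (rule Bochner_Integration.integral_cong) (use assms in \<open>auto simp: indicator_def\<close>)

text \<open>A test field supported in \<open>K\<close> is also one for \<Omega>, and both integrands
  vanish off its support, so integrating over \<open>K\<close> or over \<Omega> gives the same
  value.\<close>

lemma weak_grad_subset:
  assumes "weak_grad \<Omega> v g" "K \<subseteq> \<Omega>" shows "weak_grad K v g"
  unfolding weak_grad_def
proof (intro allI impI)
  fix \<psi> :: "'a \<Rightarrow> 'a" assume \<psi>: "C1c_on K \<psi>"
  then have s: "tsupp \<psi> \<subseteq> K" by (simp add: C1c_on_def)
  have "(LINT x:K|lebesgue. v x * cdiv \<psi> x) = (LINT x:\<Omega>|lebesgue. v x * cdiv \<psi> x)"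
    by (rule set_integral_eq_subset[OF assms(2)]) (use s cdiv_outside_tsupp[of _ \<psi>] in \<open>metis mult_zero_right subsetD\<close>)
  moreover have "(LINT x:K|lebesgue. g x \<bullet> \<psi> x) = (LINT x:\<Omega>|lebesgue. g x \<bullet> \<psi> x)"
    by (rule set_integral_eq_subset[OF assms(2)]) (use s eq_0_outside_tsupp[of _ \<psi>] in \<open>metis inner_zero_right subsetD\<close>)
  ultimately show "(LINT x:K|lebesgue. v x * cdiv \<psi> x) = - (LINT x:K|lebesgue. g x \<bullet> \<psi> x)"
    using assms C1c_on_mono[OF \<psi> assms(2)] by (simp add: weak_grad_def)
qed

lemma weak_div_subset:
  assumes "weak_div \<Omega> w d" "K \<subseteq> \<Omega>" shows "weak_div K w d"
  unfolding weak_div_def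
proof (intro allI impI)
  fix \<phi> :: "'a \<Rightarrow> real" assume \<phi>: "C1c_on K \<phi>"
  then have s: "tsupp \<phi> \<subseteq> K" by (simp add: C1c_on_def)
  have "(LINT x:K|lebesgue. w x \<bullet> cgrad \<phi> x) = (LINT x:\<Omega>|lebesgue. w x \<bullet> cgrad \<phi> x)"
    by (rule set_integral_eq_subset[OF assms(2)]) (use s cgrad_outside_tsupp[of _ \<phi>] in \<open>metis inner_zero_right subsetD\<close>)
  moreover have "(LINT x:K|lebesgue. d x * \<phi> x) = (LINT x:\<Omega>|lebesgue. d x * \<phi> x)"
    by (rule set_integral_eq_subset[OF assms(2)]) (use s eq_0_outside_tsupp[of _ \<phi>] in \<open>metis mult_zero_right subsetD\<close>)
  ultimately show "(LINT x:K|lebesgue. w x \<bullet> cgrad \<phi> x) = - (LINT x:K|lebesgue. d x * \<phi> x)"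
    using assms C1c_on_mono[OF \<phi> assms(2)] by (simp add: weak_div_def)
qed

text \<open>The supremum in \<open>jump_norm_tau\<close> ranges over functions on \<Omega>, while
  the pairing uses \<open>wgrad K\<close>; that choice is a weak gradient only once one is known to
  exist on \<open>K\<close>. \<open>Hdiv_subset\<close> does the same for
  \<open>jump_norm_v\<close>.\<close>

lemma H1_subset:
  assumes "H1 \<Omega> v" "K \<subseteq> \<Omega>" "K \<in> sets lebesgue" shows "H1 K v"
proof -
  obtain g where "sq_int \<Omega> v" "sq_int \<Omega> g" "weak_grad \<Omega> v g"
    using assms(1) by (auto simp: H1_def L2_iff_sq_int L2v_iff_sq_int)
  then have "sq_int K v" "sq_int K g" "weak_grad K v g"
    using sq_int_subset[OF _ assms(3,2)] weak_grad_subset[OF _ assms(2)] by simp_all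
  then show ?thesis by (auto simp: H1_def L2_iff_sq_int L2v_iff_sq_int)
qed

lemma Hdiv_subset:
  assumes "Hdiv \<Omega> w" "K \<subseteq> \<Omega>" "K \<in> sets lebesgue" shows "Hdiv K w"
proof -
  obtain d where "sq_int \<Omega> w" "sq_int \<Omega> d" "weak_div \<Omega> w d"
    using assms(1) by (auto simp: Hdiv_def L2_iff_sq_int L2v_iff_sq_int)
  then have "sq_int K w" "sq_int K d" "weak_div K w d"
    using sq_int_subset[OF _ assms(3,2)] weak_div_subset[OF _ assms(2)] by simp_all
  then show ?thesis by (auto simp: Hdiv_def L2_iff_sq_int L2v_iff_sq_int)
qed

lemma H1_wgrad:
  assumes "H1 K v" shows "sq_int K v" "sq_int K (wgrad K v)" "weak_grad K v (wgrad K v)"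
proof -
  have *: "sq_int K v" "\<exists>g. L2v K g \<and> weak_grad K v g"
    using assms by (auto simp: H1_def L2_iff_sq_int)
  show "sq_int K v" "sq_int K (wgrad K v)" "weak_grad K v (wgrad K v)"
    using *(1) someI_ex[OF *(2)] by (simp_all add: wgrad_def L2v_iff_sq_int)
qed

lemma Hdiv_wdiv:
  assumes "Hdiv K w" shows "sq_int K w" "sq_int K (wdiv K w)" "weak_div K w (wdiv K w)"
proof -
  have *: "sq_int K w" "\<exists>d. L2 K d \<and> weak_div K w d"
    using assms by (auto simp: Hdiv_def L2v_iff_sq_int)
  show "sq_int K w" "sq_int K (wdiv K w)" "weak_div K w (wdiv K w)"
    using *(1) someI_ex[OF *(2)] by (simp_all add: wdiv_def L2_iff_sq_int)
qed

section \<open>Continuously differentiable functions, bumps and cutoffs\<close>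

text \<open>The smoothness half of \<open>C1c_on\<close>, kept apart from the support because
  compactly supported functions get multiplied by fields that reach the boundary.\<close>

definition C1 :: "('a::euclidean_space \<Rightarrow> 'b::euclidean_space) \<Rightarrow> bool" where
  "C1 f \<longleftrightarrow> (\<exists>D. (\<forall>x. (f has_derivative D x) (at x)) \<and> (\<forall>h. continuous_on UNIV (\<lambda>x. D x h)))"

lemma C1c_on_iff: "C1c_on U f \<longleftrightarrow> C1 f \<and> compact (tsupp f) \<and> tsupp f \<subseteq> U"
  by (simp add: C1c_on_def C1_def)

lemma C1I:
  "(\<And>x. (f has_derivative D x) (at x)) \<Longrightarrow> (\<And>h. continuous_on UNIV (\<lambda>x. D x h)) \<Longrightarrow> C1 f"
  by (auto simp: C1_def)

lemma C1D:
  assumes "C1 f"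
  shows "(f has_derivative frechet_derivative f (at x)) (at x)"
    and "continuous_on UNIV (\<lambda>x. frechet_derivative f (at x) h)"
proof -
  obtain D where D: "\<And>x. (f has_derivative D x) (at x)" "\<And>h. continuous_on UNIV (\<lambda>x. D x h)"
    using assms by (auto simp: C1_def)
  have "frechet_derivative f (at x) = D x" for x
    using frechet_derivative_at[OF D(1)] by simp
  then show "(f has_derivative frechet_derivative f (at x)) (at x)"
    "continuous_on UNIV (\<lambda>x. frechet_derivative f (at x) h)" using D by auto
qed

lemma C1_continuous_on: "C1 f \<Longrightarrow> continuous_on A f"
  by (meson C1D(1) continuous_at_imp_continuous_on has_derivative_continuous)

lemma C1_const: "C1 (\<lambda>x. c)"
  by (rule C1I[where D="\<lambda>x h. 0"]) auto

lemma C1_diff: "C1 f \<Longrightarrow> C1 g \<Longrightarrow> C1 (\<lambda>x. f x - g x)"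
  by (rule C1I[where D="\<lambda>x h. frechet_derivative f (at x) h - frechet_derivative g (at x) h"])
     (auto intro!: has_derivative_diff continuous_on_diff C1D)

lemma C1_scaleR:
  fixes f :: "'a::euclidean_space \<Rightarrow> real" and g :: "'a \<Rightarrow> 'b::euclidean_space"
  assumes "C1 f" "C1 g"
  shows "C1 (\<lambda>x. f x *\<^sub>R g x)"
  by (rule C1I[where D="\<lambda>x h. f x *\<^sub>R frechet_derivative g (at x) h + frechet_derivative f (at x) h *\<^sub>R g x"])
     (rule has_derivative_scaleR continuous_on_add continuous_on_scaleR C1D C1_continuous_on assms)+

lemma C1_mult:
  fixes f g :: "'a::euclidean_space \<Rightarrow> real"
  shows "C1 f \<Longrightarrow> C1 g \<Longrightarrow> C1 (\<lambda>x. f x * g x)"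
  using C1_scaleR[of f g] by simp

lemma C1_power:
  fixes f :: "'a::euclidean_space \<Rightarrow> real"
  assumes "C1 f" shows "C1 (\<lambda>x. f x ^ n)"
  by (induction n) (auto intro: C1_const C1_mult assms)

lemma C1_prod:
  fixes f :: "'i \<Rightarrow> 'a::euclidean_space \<Rightarrow> real"
  assumes "finite I" "\<And>i. i \<in> I \<Longrightarrow> C1 (f i)" shows "C1 (\<lambda>x. \<Prod>i\<in>I. f i x)"
  using assms by (induction I rule: finite_induct) (auto intro: C1_const C1_mult)

lemma C1_inner_const:
  assumes "C1 f" shows "C1 (\<lambda>x. f x \<bullet> b)"
  by (rule C1I[where D="\<lambda>x h. frechet_derivative f (at x) h \<bullet> b"])
     (auto intro!: has_derivative_inner_left continuous_on_inner continuous_on_const C1D assms)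

text \<open>Squaring removes the kink of the positive part: at 0 the difference quotient with
  increment h is just max 0 h, which tends to 0.\<close>

lemma has_real_derivative_pos_part_sq:
  "((\<lambda>t. (max 0 t)\<^sup>2) has_real_derivative 2 * max 0 t) (at t)"
proof -
  consider "t > 0" | "t < 0" | "t = 0" by linarith
  then show ?thesis
  proof cases
    case 1
    have "((\<lambda>t. t\<^sup>2) has_real_derivative 2 * max 0 t) (at t)"
      using 1 by (auto intro!: derivative_eq_intros)
    then show ?thesis
      by (rule has_field_derivative_transform_within_open[where S="{0<..}"]) (use 1 in auto)
  next
    case 2
    have "((\<lambda>t. 0) has_real_derivative 2 * max 0 t) (at t)"
      using 2 by (auto intro!: derivative_eq_intros)
    then show ?thesis
      by (rule has_field_derivative_transform_within_open[where S="{..<0}"]) (use 2 in auto)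
  next
    case 3
    have "((\<lambda>h::real. max 0 h) \<longlongrightarrow> max 0 0) (at 0)" by (intro tendsto_intros)
    then have "((\<lambda>h::real. ((max 0 (0 + h))\<^sup>2 - (max 0 0)\<^sup>2) / h) \<longlongrightarrow> 0) (at 0)"
      by (subst (asm) max.idem, elim Lim_transform_eventually)
         (auto simp: eventually_at_filter max_def power2_eq_square)
    then show ?thesis using 3 by (simp add: DERIV_def)
  qed
qed

text \<open>\<open>C1c_on\<close> asks for one continuous derivative only, so a truncated polynomial
  replaces the usual exponential bump. For \<open>r > 0\<close> it is positive exactly on the open
  ball.\<close>

definition bump :: "'a::euclidean_space \<Rightarrow> real \<Rightarrow> 'a \<Rightarrow> real" where
  "bump c r x = (max 0 (r\<^sup>2 - (x - c) \<bullet> (x - c)))\<^sup>2"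

lemma C1_bump: "C1 (bump c r)"
proof (rule C1I)
  let ?u = "\<lambda>x. r\<^sup>2 - (x - c) \<bullet> (x - c)"
  fix x
  have u: "(?u has_derivative (\<lambda>h. - 2 * ((x - c) \<bullet> h))) (at x)"
    by (auto intro!: derivative_eq_intros simp: inner_commute)
  have "((\<lambda>t. (max 0 t)\<^sup>2) has_derivative (\<lambda>h. h * (2 * max 0 (?u x)))) (at (?u x))"
    using has_real_derivative_pos_part_sq[of "?u x"]
    by (simp add: has_field_derivative_def mult_commute_abs)
  from has_derivative_compose[OF u this]
  show "(bump c r has_derivative (\<lambda>h. - 2 * ((x - c) \<bullet> h) * (2 * max 0 (?u x)))) (at x)"
    by (simp add: bump_def[abs_def])
next
  fix h show "continuous_on UNIV (\<lambda>x. - 2 * ((x - c) \<bullet> h) * (2 * max 0 (r\<^sup>2 - (x - c) \<bullet> (x - c))))"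
    by (intro continuous_intros)
qed

lemma norm_sq_less: "r > 0 \<Longrightarrow> dist c x < r \<longleftrightarrow> (x - c) \<bullet> (x - c) < r\<^sup>2"
  by (metis abs_of_pos dist_commute dist_norm norm_lt_square power2_eq_square)

lemma bump_pos_iff: "r > 0 \<Longrightarrow> bump c r x > 0 \<longleftrightarrow> x \<in> ball c r"
  by (auto simp: bump_def norm_sq_less max_def)

lemma bump_nonneg: "0 \<le> bump c r x"
  by (simp add: bump_def)

lemma bump_le_1:
  assumes "0 < r" "r \<le> 1" shows "bump c r x \<le> 1"
proof -
  have "r\<^sup>2 \<le> 1" using assms by (simp add: power_le_one)
  then have "max 0 (r\<^sup>2 - (x - c) \<bullet> (x - c)) \<le> 1"
    using inner_ge_zero[of "x - c"] by linarith
  then show ?thesis unfolding bump_def by (intro power_le_one) auto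
qed

lemma compact_tsuppI:
  fixes f :: "'a::euclidean_space \<Rightarrow> 'b::euclidean_space"
  assumes "compact S" "\<And>x. f x \<noteq> 0 \<Longrightarrow> x \<in> S"
  shows "compact (tsupp f)" "tsupp f \<subseteq> S"
proof -
  show s: "tsupp f \<subseteq> S"
    unfolding tsupp_def by (rule closure_minimal) (use assms compact_imp_closed in auto)
  show "compact (tsupp f)"
    using assms(1) s compact_Int_closed[of S "tsupp f"] by (simp add: tsupp_def Int_absorb1)
qed

lemma C1c_on_bump:
  assumes "r > 0" "cball c r \<subseteq> U" shows "C1c_on U (bump c r)"
proof -
  have "x \<in> cball c r" if "bump c r x \<noteq> 0" for x
    using that bump_pos_iff[OF assms(1), of c x] bump_nonneg[of c r x] by (auto simp: less_le)
  from compact_tsuppI[of "cball c r" "bump c r", OF _ this] show ?thesis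
    using assms by (auto simp: C1c_on_iff C1_bump)
qed

lemma C1c_on_scaleR:
  fixes f :: "'a::euclidean_space \<Rightarrow> real" and g :: "'a \<Rightarrow> 'b::euclidean_space"
  assumes "C1c_on U f" "C1 g" shows "C1c_on U (\<lambda>x. f x *\<^sub>R g x)"
  using assms compact_tsuppI[of "tsupp f" "\<lambda>x. f x *\<^sub>R g x"] eq_0_outside_tsupp[of _ f] C1_scaleR[of f g]
  unfolding C1c_on_iff by fastforce

text \<open>By Lindelof, countably many balls with closed ball inside \<open>U\<close> cover
  \<open>U\<close>. The cutoff combines the bumps of the first \<open>n\<close> balls, hence has
  compact support in \<open>U\<close>. Values in [0, 1] and pointwise convergence are what dominated
  convergence will ask for.\<close>

lemma exhausting_cutoffs:
  fixes U :: "'a::euclidean_space set"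
  assumes "open U"
  obtains \<eta> :: "nat \<Rightarrow> 'a \<Rightarrow> real"
  where "\<And>n. C1c_on U (\<eta> n)" "\<And>n x. 0 \<le> \<eta> n x" "\<And>n x. \<eta> n x \<le> 1"
    "\<And>x. x \<in> U \<Longrightarrow> (\<lambda>n. \<eta> n x) \<longlonglongrightarrow> 1"
proof -
  \<comment> \<open>Radius at most 1 keeps each bump below 1, so that all factors of the product
    below lie in [0, 1].\<close>
  have "\<exists>r. 0 < r \<and> r \<le> 1 \<and> cball x r \<subseteq> U" if x: "x \<in> U" for x
  proof -
    obtain e where "e > 0" "cball x e \<subseteq> U" using assms x open_contains_cball by blast
    then show ?thesis by (intro exI[of _ "min e 1"]) auto
  qed
  then obtain R where R: "\<And>x. x \<in> U \<Longrightarrow> 0 < R x \<and> R x \<le> 1 \<and> cball x (R x) \<subseteq> U" by metis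
  obtain \<F> where \<F>: "\<F> \<subseteq> (\<lambda>x. ball x (R x)) ` U" "countable \<F>" "\<Union>\<F> = \<Union>((\<lambda>x. ball x (R x)) ` U)"
    using Lindelof[of "(\<lambda>x. ball x (R x)) ` U"] by auto
  obtain C where C: "C \<subseteq> U" "countable C" "\<F> = (\<lambda>x. ball x (R x)) ` C"
    using countable_subset_image[of \<F> "\<lambda>x. ball x (R x)" U] \<F> by auto
  have cover: "\<exists>c\<in>C. x \<in> ball c (R c)" if "x \<in> U" for x
    using \<F>(3) C(3) that R[OF that] by force
  \<comment> \<open>The zero function serves the case of empty \<open>C\<close>, where there is no
    centre to enumerate.\<close>
  define s where "s i = (if C = {} then (\<lambda>x. 0) else bump (from_nat_into C i) (R (from_nat_into C i)))" for i
  have in_C: "from_nat_into C i \<in> U" if "C \<noteq> {}" for i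
    using from_nat_into[OF that] C(1) by auto
  have s01: "0 \<le> s i x" "s i x \<le> 1" for i x
    using R[OF in_C, of i] by (auto simp: s_def bump_nonneg bump_le_1)
  have sC: "C1c_on U (s i)" for i
  proof (cases "C = {}")
    case True
    then show ?thesis using C1_const[of 0] compact_tsuppI[of "{}" "s i"] by (simp add: s_def C1c_on_iff tsupp_def)
  next
    case False
    then show ?thesis using R[OF in_C[OF False], of i] by (simp add: s_def C1c_on_bump)
  qed
  \<comment> \<open>The power \<open>n\<close> makes a single bump sufficient: if
    \<open>s j x > 0\<close>, then (1 - s j x)^n tends to 0 and drags the whole product
    along.\<close>
  define \<eta> where "\<eta> n x = 1 - (\<Prod>i<n. (1 - s i x) ^ n)" for n x
  have p01: "0 \<le> (\<Prod>i<n. (1 - s i x) ^ n)" "(\<Prod>i<n. (1 - s i x) ^ n) \<le> 1" for n x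
    using s01[of _ x] by (auto intro!: prod_nonneg prod_le_1 power_le_one)
  show thesis
  proof
    fix n
    have "C1 (\<eta> n)" unfolding \<eta>_def
      using sC by (intro C1_diff C1_const C1_prod C1_power) (auto simp: C1c_on_iff)
    moreover have "x \<in> (\<Union>i<n. tsupp (s i))" if "\<eta> n x \<noteq> 0" for x
    proof (rule ccontr)
      assume "x \<notin> (\<Union>i<n. tsupp (s i))"
      then have "s i x = 0" if "i < n" for i using that eq_0_outside_tsupp[of x "s i"] by auto
      then show False using \<open>\<eta> n x \<noteq> 0\<close> by (simp add: \<eta>_def)
    qed
    moreover have "compact (\<Union>i<n. tsupp (s i))" "(\<Union>i<n. tsupp (s i)) \<subseteq> U"
      using sC by (auto simp: C1c_on_iff)
    ultimately show "C1c_on U (\<eta> n)"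
      using compact_tsuppI[of "\<Union>i<n. tsupp (s i)" "\<eta> n"] by (auto simp: C1c_on_iff)
  next
    fix n x show "0 \<le> \<eta> n x" "\<eta> n x \<le> 1" using p01[of x n] by (auto simp: \<eta>_def)
  next
    fix x assume "x \<in> U"
    then obtain c where c: "c \<in> C" "x \<in> ball c (R c)" using cover by blast
    then have ne: "C \<noteq> {}" by auto
    obtain j where j: "from_nat_into C j = c"
      using c(1) from_nat_into_surj[OF C(2)] by blast
    have "s j x > 0" using c R[of c] C(1) bump_pos_iff[of "R c" c x] by (auto simp: s_def ne j)
    then have lim: "(\<lambda>n. (1 - s j x) ^ n) \<longlonglongrightarrow> 0"
      using s01[of j x] by (intro LIMSEQ_power_zero) auto
    have le: "(\<Prod>i<n. (1 - s i x) ^ n) \<le> (1 - s j x) ^ n" if "n > j" for n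
    proof -
      have "(\<Prod>i<n. (1 - s i x) ^ n) = (1 - s j x) ^ n * (\<Prod>i\<in>{..<n} - {j}. (1 - s i x) ^ n)"
        using that by (subst prod.remove[of _ j]) auto
      also have "\<dots> \<le> (1 - s j x) ^ n * 1"
        using s01[of _ x] by (intro mult_left_mono prod_le_1 power_le_one zero_le_power conjI) auto
      finally show ?thesis by simp
    qed
    have "(\<lambda>n. \<Prod>i<n. (1 - s i x) ^ n) \<longlonglongrightarrow> 0"
    proof (rule tendsto_sandwich[OF _ _ tendsto_const lim])
      show "\<forall>\<^sub>F n in sequentially. 0 \<le> (\<Prod>i<n. (1 - s i x) ^ n)" using p01 by simp
      show "\<forall>\<^sub>F n in sequentially. (\<Prod>i<n. (1 - s i x) ^ n) \<le> (1 - s j x) ^ n"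
        using eventually_gt_at_top[of j] by eventually_elim (rule le)
    qed
    from tendsto_diff[OF tendsto_const[of 1] this] show "(\<lambda>n. \<eta> n x) \<longlonglongrightarrow> 1"
      by (simp add: \<eta>_def)
  qed
qed

section \<open>Green's formula for continuously differentiable functions\<close>

lemma compactly_supported_integrable:
  fixes f :: "'a::euclidean_space \<Rightarrow> real"
  assumes "continuous_on UNIV f" "compact S" "\<And>x. x \<notin> S \<Longrightarrow> f x = 0"
  shows "integrable lborel f"
proof -
  have "integrable lborel (\<lambda>x. indicator S x *\<^sub>R f x)"
    using assms by (intro borel_integrable_compact) (auto intro: continuous_on_subset)
  also have "(\<lambda>x. indicator S x *\<^sub>R f x) = f"
    using assms(3) by (intro ext) (metis indicator_simps(1,2) scaleR_one scaleR_zero_left)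
  finally show ?thesis .
qed

text \<open>By translation invariance, all difference quotients of \<open>f\<close> have integral zero; pass to the limit.\<close>
lemma integral_derivative_compact_support:
  fixes f :: "'a::euclidean_space \<Rightarrow> real"
  assumes "C1 f" "compact (tsupp f)"
  shows "integrable lborel (\<lambda>x. frechet_derivative f (at x) h)"
    and "(LINT x|lborel. frechet_derivative f (at x) h) = 0"
proof -
  define d where "d x = frechet_derivative f (at x) h" for x
  have cd: "continuous_on UNIV d" unfolding d_def by (rule C1D(2)[OF assms(1)])
  have d0: "d x = 0" if "x \<notin> tsupp f" for x
    using that by (simp add: d_def frechet_derivative_outside_tsupp)
  show int_d: "integrable lborel (\<lambda>x. frechet_derivative f (at x) h)"
    using compactly_supported_integrable[OF cd assms(2) d0] by (simp add: d_def)
  have int_f: "integrable lborel f"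
    by (rule compactly_supported_integrable[OF C1_continuous_on[OF assms(1)] assms(2)])
       (rule eq_0_outside_tsupp)
  have mf: "f \<in> borel_measurable borel"
    by (rule borel_measurable_continuous_onI) (rule C1_continuous_on[OF assms(1)])
  have "bounded (d ` tsupp f)"
    by (intro compact_imp_bounded compact_continuous_image assms continuous_on_subset[OF cd]) auto
  then obtain M where M0: "M > 0" "\<And>x. x \<in> tsupp f \<Longrightarrow> \<bar>d x\<bar> \<le> M"
    by (auto simp: bounded_pos)
  then have M: "\<bar>d x\<bar> \<le> M" for x using d0[of x] by (cases "x \<in> tsupp f") auto
  obtain R where R: "\<And>x. x \<in> tsupp f \<Longrightarrow> norm x \<le> R"
    using compact_imp_bounded[OF assms(2)] by (auto simp: bounded_iff)
  define q where "q n x = real (Suc n) * (f (x + inverse (real (Suc n)) *\<^sub>R h) - f x)" for n x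
  have line: "((\<lambda>t. f (x + t *\<^sub>R h)) has_real_derivative d (x + t *\<^sub>R h)) (at t)" for x t
  proof -
    have "((\<lambda>t. x + t *\<^sub>R h) has_derivative (\<lambda>s. s *\<^sub>R h)) (at t)"
      by (auto intro!: derivative_eq_intros)
    from has_derivative_compose[OF this C1D(1)[OF assms(1)]]
    have 1: "((\<lambda>t. f (x + t *\<^sub>R h)) has_derivative
        (\<lambda>s. frechet_derivative f (at (x + t *\<^sub>R h)) (s *\<^sub>R h))) (at t)" .
    have "linear (frechet_derivative f (at (x + t *\<^sub>R h)))"
      by (rule has_derivative_linear[OF C1D(1)[OF assms(1)]])
    then have "frechet_derivative f (at (x + t *\<^sub>R h)) (s *\<^sub>R h) = d (x + t *\<^sub>R h) * s" for s
      by (simp add: linear_cmul d_def)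
    with 1 show ?thesis by (simp add: has_field_derivative_def)
  qed
  have lim: "(\<lambda>n. q n x) \<longlonglongrightarrow> d x" for x
  proof -
    have "((\<lambda>t. (f (x + (0 + t) *\<^sub>R h) - f (x + 0 *\<^sub>R h)) / t) \<longlongrightarrow> d (x + 0 *\<^sub>R h)) (at 0)"
      using line[of x 0] unfolding DERIV_def .
    then have "((\<lambda>t. (f (x + t *\<^sub>R h) - f x) / t) \<longlongrightarrow> d x) (at 0)" by simp
    moreover have "filterlim (\<lambda>n. inverse (real (Suc n))) (at 0) sequentially"
      using LIMSEQ_inverse_real_of_nat by (simp add: filterlim_at)
    ultimately have "(\<lambda>n. (f (x + inverse (real (Suc n)) *\<^sub>R h) - f x) / inverse (real (Suc n))) \<longlonglongrightarrow> d x"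
      by (rule filterlim_compose)
    then show ?thesis by (simp add: q_def divide_inverse mult.commute)
  qed
  \<comment> \<open>By the mean value theorem the quotient is a value of \<open>d\<close> at a point
    of the segment from \<open>x\<close> to x + h. If that value is nonzero, the point has norm at
    most \<open>R\<close>, so \<open>x\<close> has norm at most R + norm h: one integrable majorant
    for all \<open>n\<close>.\<close>
  have bound: "\<bar>q n x\<bar> \<le> M * indicator (cball 0 (R + norm h)) x" for n x
  proof -
    define t where "t = inverse (real (Suc n))"
    have t: "0 < t" "t \<le> 1" by (auto simp: t_def inverse_le_1_iff)
    obtain z where z: "0 < z" "z < t" "f (x + t *\<^sub>R h) - f (x + 0 *\<^sub>R h) = (t - 0) * d (x + z *\<^sub>R h)"
      using MVT2[OF t(1), of "\<lambda>t. f (x + t *\<^sub>R h)" "\<lambda>t. d (x + t *\<^sub>R h)"] line by blast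
    have q: "q n x = d (x + z *\<^sub>R h)"
      using z(3) t(1) by (simp add: q_def t_def field_simps)
    show ?thesis
    proof (cases "x + z *\<^sub>R h \<in> tsupp f")
      case True
      have "norm x \<le> norm (x + z *\<^sub>R h) + norm (z *\<^sub>R h)"
        by (metis add_diff_cancel_right' norm_triangle_ineq4)
      also have "norm (z *\<^sub>R h) \<le> norm h" using z t by (simp add: mult_left_le_one_le)
      finally show ?thesis using R[OF True] M by (simp add: q indicator_def)
    next
      case False
      then show ?thesis using M0 by (simp add: q d0)
    qed
  qed
  have q0: "(LINT x|lborel. q n x) = 0" for n
  proof -
    let ?c = "inverse (real (Suc n)) *\<^sub>R h"
    have "integrable (distr lborel borel ((+) ?c)) f"
      using int_f by (simp add: lborel_distr_plus)
    then have i: "integrable lborel (\<lambda>x. f (?c + x))" by (subst (asm) integrable_distr_eq) (use mf in auto)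
    have "(LINT x|lborel. f (?c + x)) = (LINT x|distr lborel borel ((+) ?c). f x)"
      by (subst integral_distr) (use mf in auto)
    also have "\<dots> = (LINT x|lborel. f x)" by (simp add: lborel_distr_plus)
    finally show ?thesis using i int_f by (simp add: q_def add.commute)
  qed
  have "(\<lambda>n. LINT x|lborel. q n x) \<longlonglongrightarrow> (LINT x|lborel. d x)"
  proof (rule integral_dominated_convergence[where w="\<lambda>x. M * indicator (cball 0 (R + norm h)) x"])
    show "d \<in> borel_measurable lborel" using borel_measurable_continuous_onI[OF cd] by simp
    show "q n \<in> borel_measurable lborel" for n using mf unfolding q_def by measurable
    show "integrable lborel (\<lambda>x. M * indicator (cball (0::'a) (R + norm h)) x)"
      using emeasure_bounded_finite[of "cball (0::'a) (R + norm h)"]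
      by (intro integrable_mult_right integrable_real_indicator) auto
  qed (use lim bound in auto)
  then show "(LINT x|lborel. frechet_derivative f (at x) h) = 0"
    using LIMSEQ_unique[OF _ tendsto_const] by (simp add: q0 d_def)
qed

lemma continuous_on_cgrad: "C1 f \<Longrightarrow> continuous_on A (cgrad f)"
  unfolding cgrad_def by (rule continuous_on_subset[where s=UNIV]) (auto intro!: continuous_intros C1D)

lemma continuous_on_cdiv: "C1 f \<Longrightarrow> continuous_on A (cdiv f)"
  unfolding cdiv_def by (rule continuous_on_subset[where s=UNIV]) (auto intro!: continuous_intros C1D)

text \<open>Product rule: the integrand is the sum over \<open>b\<close> of the derivative of
  \<open>G b\<close> in direction \<open>b\<close>, and each of these integrates to zero. The
  condition on \<open>S\<close> lets either factor carry the compact support, the field in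
  \<open>C1_weak_grad\<close> and the scalar function in \<open>C1_weak_div\<close>.\<close>

lemma Green_identity:
  fixes f :: "'a::euclidean_space \<Rightarrow> real" and F :: "'a \<Rightarrow> 'a"
  assumes "C1 f" "C1 F" and cpt: "compact S" and sub: "S \<subseteq> \<Omega>"
    and zero: "\<And>x. x \<notin> S \<Longrightarrow> f x = 0 \<or> F x = 0"
  shows "(LINT x:\<Omega>|lebesgue. f x * cdiv F x + cgrad f x \<bullet> F x) = 0"
proof -
  define G where "G b x = f x * (F x \<bullet> b)" for b x
  have CG: "C1 (G b)" for b unfolding G_def by (intro C1_mult C1_inner_const assms)
  have nz: "G b x \<noteq> 0 \<Longrightarrow> x \<in> S" for b x
    using zero[of x] unfolding G_def by (metis inner_zero_left mult_zero_left mult_zero_right)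
  have SG: "compact (tsupp (G b))" "tsupp (G b) \<subseteq> \<Omega>" for b
    using compact_tsuppI[OF cpt nz[of b]] sub by auto
  have dG: "frechet_derivative (G b) (at x) h
     = f x * (frechet_derivative F (at x) h \<bullet> b) + frechet_derivative f (at x) h * (F x \<bullet> b)" for b x h
  proof -
    have "(G b has_derivative (\<lambda>h. f x * (frechet_derivative F (at x) h \<bullet> b)
        + frechet_derivative f (at x) h * (F x \<bullet> b))) (at x)"
      unfolding G_def by (intro has_derivative_mult has_derivative_inner_left C1D assms)
    from frechet_derivative_at[OF this] show ?thesis by (metis (mono_tags, lifting))
  qed
  have eq: "f x * cdiv F x + cgrad f x \<bullet> F x = (\<Sum>b\<in>Basis. frechet_derivative (G b) (at x) b)" for x
    by (simp add: dG cdiv_def cgrad_def sum_distrib_left sum.distrib inner_sum_left inner_commute[of "F x"])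
  have "continuous_on UNIV (\<lambda>x. f x * cdiv F x + cgrad f x \<bullet> F x)"
    using assms by (intro continuous_intros C1_continuous_on continuous_on_cdiv continuous_on_cgrad)
  then have m: "(\<lambda>x. f x * cdiv F x + cgrad f x \<bullet> F x) \<in> borel_measurable lborel"
    using borel_measurable_continuous_onI by simp
  \<comment> \<open>Lets the integral over \<Omega> be taken over the whole space, where
    \<open>integral_derivative_compact_support\<close> applies.\<close>
  have z: "f x * cdiv F x + cgrad f x \<bullet> F x = 0" if "x \<notin> \<Omega>" for x
  proof -
    have "x \<notin> tsupp (G b)" for b using that SG(2) by blast
    then show ?thesis by (simp add: eq frechet_derivative_outside_tsupp)
  qed
  have "(LINT x:\<Omega>|lebesgue. f x * cdiv F x + cgrad f x \<bullet> F x)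
      = (LINT x|lebesgue. f x * cdiv F x + cgrad f x \<bullet> F x)"
    unfolding set_lebesgue_integral_def
    by (rule Bochner_Integration.integral_cong) (auto simp: indicator_def z)
  also have "\<dots> = (LINT x|lborel. f x * cdiv F x + cgrad f x \<bullet> F x)"
    by (rule integral_completion[OF m])
  also have "\<dots> = (\<Sum>b\<in>Basis. LINT x|lborel. frechet_derivative (G b) (at x) b)"
    unfolding eq by (rule Bochner_Integration.integral_sum) (rule integral_derivative_compact_support[OF CG SG(1)])
  also have "\<dots> = 0"
    by (simp add: integral_derivative_compact_support(2)[OF CG SG(1)])
  finally show ?thesis .
qed

section \<open>Compactly supported functions belong to the spaces with boundary conditions\<close>

lemma sq_int_continuous:
  fixes f :: "'a::euclidean_space \<Rightarrow> 'b::euclidean_space"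
  assumes "continuous_on UNIV f" "bounded \<Omega>" "open \<Omega>"
  shows "sq_int \<Omega> f"
proof -
  have "compact (closure \<Omega>)" using assms by simp
  then have "integrable lborel (\<lambda>x. indicator (closure \<Omega>) x *\<^sub>R (norm (f x))\<^sup>2)"
    by (rule borel_integrable_compact) (intro continuous_intros continuous_on_subset[OF assms(1)], simp)
  then have "set_integrable lebesgue (closure \<Omega>) (\<lambda>x. (norm (f x))\<^sup>2)"
    unfolding set_integrable_def by (subst integrable_completion) auto
  then have "set_integrable lebesgue \<Omega> (\<lambda>x. (norm (f x))\<^sup>2)"
    by (rule set_integrable_subset) (use assms closure_subset in auto)
  moreover have "set_borel_measurable lebesgue \<Omega> f"
  proof -
    have "f \<in> borel_measurable lebesgue"
      using borel_measurable_continuous_onI[OF assms(1)] by (simp add: measurable_completion)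
    then show ?thesis unfolding set_borel_measurable_def
      using assms(3) by (intro borel_measurable_scaleR borel_measurable_indicator) auto
  qed
  ultimately show ?thesis by (simp add: sq_int_def)
qed

text \<open>Only compactly supported test functions enter the definitions of \<^const>\<open>weak_grad\<close> and
  \<^const>\<open>weak_div\<close>; multiplying by cutoffs extends the orthogonality up to the boundary, which
  replaces the a.e. uniqueness of weak derivatives.\<close>
lemma orthogonal_C1c_imp_orthogonal_C1:
  fixes g \<psi> :: "'a::euclidean_space \<Rightarrow> 'b::euclidean_space"
  assumes \<Omega>: "open \<Omega>" "bounded \<Omega>" and g: "sq_int \<Omega> g"
    and orth: "\<And>\<psi>. C1c_on \<Omega> \<psi> \<Longrightarrow> (LINT x:\<Omega>|lebesgue. g x \<bullet> \<psi> x) = 0"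
    and \<psi>: "C1 \<psi>"
  shows "(LINT x:\<Omega>|lebesgue. g x \<bullet> \<psi> x) = 0"
proof -
  obtain \<eta> :: "nat \<Rightarrow> 'a \<Rightarrow> real" where \<eta>: "\<And>n. C1c_on \<Omega> (\<eta> n)" "\<And>n x. 0 \<le> \<eta> n x" "\<And>n x. \<eta> n x \<le> 1"
    "\<And>x. x \<in> \<Omega> \<Longrightarrow> (\<lambda>n. \<eta> n x) \<longlonglongrightarrow> 1"
    using exhausting_cutoffs[OF \<Omega>(1)] by blast
  have "set_integrable lebesgue \<Omega> (\<lambda>x. g x \<bullet> \<psi> x)"
    by (rule sq_int_inner[OF g]) (rule sq_int_continuous[OF C1_continuous_on[OF \<psi>] \<Omega>(2,1)])
  then have int: "integrable lebesgue (\<lambda>x. indicator \<Omega> x *\<^sub>R (g x \<bullet> \<psi> x))"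
    by (simp add: set_integrable_def)
  let ?s = "\<lambda>n x. indicat_real \<Omega> x *\<^sub>R (g x \<bullet> (\<eta> n x *\<^sub>R \<psi> x))"
  have seq: "?s n x = \<eta> n x * (indicator \<Omega> x *\<^sub>R (g x \<bullet> \<psi> x))" for n x by simp
  have "(\<lambda>n. LINT x|lebesgue. ?s n x) \<longlonglongrightarrow> (LINT x|lebesgue. indicator \<Omega> x *\<^sub>R (g x \<bullet> \<psi> x))"
  proof (rule integral_dominated_convergence[where w="\<lambda>x. \<bar>indicator \<Omega> x *\<^sub>R (g x \<bullet> \<psi> x)\<bar>"])
    show "(\<lambda>x. indicator \<Omega> x *\<^sub>R (g x \<bullet> \<psi> x)) \<in> borel_measurable lebesgue"
      using int by (rule borel_measurable_integrable)
    have "\<eta> n \<in> borel_measurable lebesgue" for n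
      using borel_measurable_continuous_onI[OF C1_continuous_on, of "\<eta> n"] \<eta>(1)[of n]
      by (simp add: C1c_on_iff measurable_completion)
    then show "?s n \<in> borel_measurable lebesgue" for n
      unfolding seq by (intro borel_measurable_times borel_measurable_integrable[OF int])
    show "integrable lebesgue (\<lambda>x. \<bar>indicator \<Omega> x *\<^sub>R (g x \<bullet> \<psi> x)\<bar>)"
      using int by (rule integrable_abs)
    have "(\<lambda>n. ?s n x) \<longlonglongrightarrow> indicator \<Omega> x *\<^sub>R (g x \<bullet> \<psi> x)" for x
    proof (cases "x \<in> \<Omega>")
      case True
      from tendsto_mult_right[OF \<eta>(4)[OF True], of "g x \<bullet> \<psi> x"] True show ?thesis by simp
    qed simp
    then show "AE x in lebesgue. (\<lambda>n. ?s n x) \<longlonglongrightarrow> indicator \<Omega> x *\<^sub>R (g x \<bullet> \<psi> x)" by simp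
    have "norm (?s n x) \<le> \<bar>indicator \<Omega> x *\<^sub>R (g x \<bullet> \<psi> x)\<bar>" for n x
      unfolding seq using \<eta>(2,3)[of n x] by (simp only: real_norm_def abs_mult) (simp add: mult_left_le_one_le)
    then show "AE x in lebesgue. norm (?s n x) \<le> \<bar>indicator \<Omega> x *\<^sub>R (g x \<bullet> \<psi> x)\<bar>" for n by simp
  qed
  moreover have "(LINT x|lebesgue. ?s n x) = 0" for n
    using orth[OF C1c_on_scaleR[OF \<eta>(1) \<psi>], of n] by (simp add: set_lebesgue_integral_def)
  ultimately have "(\<lambda>n::nat. 0) \<longlonglongrightarrow> (LINT x|lebesgue. indicator \<Omega> x *\<^sub>R (g x \<bullet> \<psi> x))"
    by simp
  then show ?thesis using LIMSEQ_unique[OF _ tendsto_const] by (auto simp: set_lebesgue_integral_def)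
qed

lemma Green_identity_split:
  fixes f :: "'a::euclidean_space \<Rightarrow> real" and F :: "'a \<Rightarrow> 'a"
  assumes \<Omega>: "open \<Omega>" "bounded \<Omega>" and C: "C1 f" "C1 F"
    and S: "compact S" "S \<subseteq> \<Omega>" "\<And>x. x \<notin> S \<Longrightarrow> f x = 0 \<or> F x = 0"
  shows "(LINT x:\<Omega>|lebesgue. f x * cdiv F x) = - (LINT x:\<Omega>|lebesgue. cgrad f x \<bullet> F x)"
proof -
  have "set_integrable lebesgue \<Omega> (\<lambda>x. f x * cdiv F x)" "set_integrable lebesgue \<Omega> (\<lambda>x. cgrad f x \<bullet> F x)"
    using C by (auto intro!: sq_int_mult sq_int_inner sq_int_continuous[OF _ \<Omega>(2,1)]
        C1_continuous_on continuous_on_cdiv continuous_on_cgrad)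
  then show ?thesis using Green_identity[OF C S] by (simp add: set_integral_add)
qed

lemma C1_weak_grad:
  fixes f :: "'a::euclidean_space \<Rightarrow> real"
  assumes \<Omega>: "open \<Omega>" "bounded \<Omega>" and "C1 f"
  shows "weak_grad \<Omega> f (cgrad f)"
  unfolding weak_grad_def
proof (intro allI impI)
  fix \<psi> :: "'a \<Rightarrow> 'a" assume "C1c_on \<Omega> \<psi>"
  then show "(LINT x:\<Omega>|lebesgue. f x * cdiv \<psi> x) = - (LINT x:\<Omega>|lebesgue. cgrad f x \<bullet> \<psi> x)"
    using assms eq_0_outside_tsupp[of _ \<psi>]
    by (intro Green_identity_split[where S="tsupp \<psi>"]) (auto simp: C1c_on_iff)
qed

lemma C1_weak_div:
  fixes F :: "'a::euclidean_space \<Rightarrow> 'a"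
  assumes \<Omega>: "open \<Omega>" "bounded \<Omega>" and "C1 F"
  shows "weak_div \<Omega> F (cdiv F)"
  unfolding weak_div_def
proof (intro allI impI)
  fix \<phi> :: "'a \<Rightarrow> real" assume "C1c_on \<Omega> \<phi>"
  then have "(LINT x:\<Omega>|lebesgue. \<phi> x * cdiv F x) = - (LINT x:\<Omega>|lebesgue. cgrad \<phi> x \<bullet> F x)"
    using assms eq_0_outside_tsupp[of _ \<phi>]
    by (intro Green_identity_split[where S="tsupp \<phi>"]) (auto simp: C1c_on_iff)
  then show "(LINT x:\<Omega>|lebesgue. F x \<bullet> cgrad \<phi> x) = - (LINT x:\<Omega>|lebesgue. cdiv F x * \<phi> x)"
    by (simp add: inner_commute mult.commute)
qed

text \<open>The chosen \<open>wgrad \<Omega> f\<close> and the classical \<open>cgrad f\<close> are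
  both weak gradients, so their difference is orthogonal to compactly supported fields and then to
  every C1 field. Green's formula for \<open>cgrad f\<close>, with the support carried by
  \<open>f\<close>, thus passes to \<open>wgrad \<Omega> f\<close>. It holds for all C1 fields,
  hence for any \<open>GD\<close>.\<close>

lemma C1c_on_in_H1_D:
  fixes f :: "'a::euclidean_space \<Rightarrow> real"
  assumes \<Omega>: "open \<Omega>" "bounded \<Omega>" and f: "C1c_on \<Omega> f"
  shows "f \<in> H1_D \<Omega> GD"
proof -
  have C: "C1 f" and S: "compact (tsupp f)" "tsupp f \<subseteq> \<Omega>" using f by (auto simp: C1c_on_iff)
  note sq = sq_int_continuous[OF _ \<Omega>(2,1)]
  have sqf: "sq_int \<Omega> f" and sqg: "sq_int \<Omega> (cgrad f)"
    using C by (auto intro: sq C1_continuous_on continuous_on_cgrad)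
  have H: "H1 \<Omega> f"
    using sqf sqg C1_weak_grad[OF \<Omega> C] by (auto simp: H1_def L2_iff_sq_int L2v_iff_sq_int)
  note W = H1_wgrad[OF H]
  have "(LINT x:\<Omega>|lebesgue. f x * cdiv \<psi> x + wgrad \<Omega> f x \<bullet> \<psi> x) = 0" if \<psi>: "C1 \<psi>" for \<psi>
  proof -
    have sq\<psi>: "sq_int \<Omega> \<psi>" "sq_int \<Omega> (cdiv \<psi>)"
      if "C1 \<psi>" for \<psi> :: "'a \<Rightarrow> 'a" using that by (auto intro: sq C1_continuous_on continuous_on_cdiv)
    have diff: "(LINT x:\<Omega>|lebesgue. (wgrad \<Omega> f x - cgrad f x) \<bullet> \<psi> x)
        = (LINT x:\<Omega>|lebesgue. wgrad \<Omega> f x \<bullet> \<psi> x) - (LINT x:\<Omega>|lebesgue. cgrad f x \<bullet> \<psi> x)"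
      if "C1 \<psi>" for \<psi>
      unfolding inner_diff_left using W(2) sqg sq\<psi>(1)[OF that]
      by (intro set_integral_diff sq_int_inner)
    have "(LINT x:\<Omega>|lebesgue. (wgrad \<Omega> f x - cgrad f x) \<bullet> \<psi> x) = 0"
    proof (rule orthogonal_C1c_imp_orthogonal_C1[OF \<Omega> sq_int_diff[OF W(2) sqg] _ \<psi>])
      fix \<psi> :: "'a \<Rightarrow> 'a" assume "C1c_on \<Omega> \<psi>"
      then show "(LINT x:\<Omega>|lebesgue. (wgrad \<Omega> f x - cgrad f x) \<bullet> \<psi> x) = 0"
        using W(3) C1_weak_grad[OF \<Omega> C] by (subst diff) (simp_all add: weak_grad_def C1c_on_iff)
    qed
    then have "(LINT x:\<Omega>|lebesgue. wgrad \<Omega> f x \<bullet> \<psi> x) = - (LINT x:\<Omega>|lebesgue. f x * cdiv \<psi> x)"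
      using diff[OF \<psi>] Green_identity_split[OF \<Omega> C \<psi> S] eq_0_outside_tsupp[of _ f] by auto
    then show ?thesis
      using sq_int_mult[OF sqf sq\<psi>(2)[OF \<psi>]] sq_int_inner[OF W(2) sq\<psi>(1)[OF \<psi>]]
      by (simp add: set_integral_add)
  qed
  then show ?thesis using H by (simp add: H1_D_def C1c_on_iff)
qed

lemma C1c_on_in_Hdiv_N:
  fixes F :: "'a::euclidean_space \<Rightarrow> 'a"
  assumes \<Omega>: "open \<Omega>" "bounded \<Omega>" and F: "C1c_on \<Omega> F"
  shows "F \<in> Hdiv_N \<Omega> GN"
proof -
  have C: "C1 F" and S: "compact (tsupp F)" "tsupp F \<subseteq> \<Omega>" using F by (auto simp: C1c_on_iff)
  note sq = sq_int_continuous[OF _ \<Omega>(2,1)]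
  have sqF: "sq_int \<Omega> F" and sqd: "sq_int \<Omega> (cdiv F)"
    using C by (auto intro: sq C1_continuous_on continuous_on_cdiv)
  have H: "Hdiv \<Omega> F"
    using sqF sqd C1_weak_div[OF \<Omega> C] by (auto simp: Hdiv_def L2_iff_sq_int L2v_iff_sq_int)
  note W = Hdiv_wdiv[OF H]
  have "(LINT x:\<Omega>|lebesgue. F x \<bullet> cgrad \<phi> x + wdiv \<Omega> F x * \<phi> x) = 0" if \<phi>: "C1 \<phi>" for \<phi>
  proof -
    have sq\<phi>: "sq_int \<Omega> \<phi>" "sq_int \<Omega> (cgrad \<phi>)"
      if "C1 \<phi>" for \<phi> :: "'a \<Rightarrow> real" using that by (auto intro: sq C1_continuous_on continuous_on_cgrad)
    \<comment> \<open>The product of reals is written as an inner product to fit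
      \<open>orthogonal_C1c_imp_orthogonal_C1\<close>.\<close>
    have diff: "(LINT x:\<Omega>|lebesgue. (wdiv \<Omega> F x - cdiv F x) \<bullet> \<phi> x)
        = (LINT x:\<Omega>|lebesgue. wdiv \<Omega> F x * \<phi> x) - (LINT x:\<Omega>|lebesgue. cdiv F x * \<phi> x)"
      if "C1 \<phi>" for \<phi>
      unfolding inner_real_def left_diff_distrib using W(2) sqd sq\<phi>(1)[OF that]
      by (intro set_integral_diff sq_int_mult)
    have "(LINT x:\<Omega>|lebesgue. (wdiv \<Omega> F x - cdiv F x) \<bullet> \<phi> x) = 0"
    proof (rule orthogonal_C1c_imp_orthogonal_C1[OF \<Omega> sq_int_diff[OF W(2) sqd] _ \<phi>])
      fix \<phi> :: "'a \<Rightarrow> real" assume "C1c_on \<Omega> \<phi>"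
      then show "(LINT x:\<Omega>|lebesgue. (wdiv \<Omega> F x - cdiv F x) \<bullet> \<phi> x) = 0"
        using W(3) C1_weak_div[OF \<Omega> C] by (subst diff) (simp_all add: weak_div_def C1c_on_iff)
    qed
    then have "(LINT x:\<Omega>|lebesgue. wdiv \<Omega> F x * \<phi> x) = - (LINT x:\<Omega>|lebesgue. F x \<bullet> cgrad \<phi> x)"
      using diff[OF \<phi>] Green_identity_split[OF \<Omega> \<phi> C S] eq_0_outside_tsupp[of _ F]
      by (auto simp: inner_commute mult.commute)
    then show ?thesis
      using sq_int_mult[OF W(2) sq\<phi>(1)[OF \<phi>]] sq_int_inner[OF sqF sq\<phi>(2)[OF \<phi>]]
      by (simp add: set_integral_add)
  qed
  then show ?thesis using H by (simp add: Hdiv_N_def C1c_on_iff)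
qed

section \<open>Functions of nonzero norm in the suprema\<close>

text \<open>A vanishing integral would force \<open>f\<close> to be zero almost everywhere on
  \<open>K\<close>, making the nonempty open set \<open>U\<close> negligible.\<close>

lemma norm_sq_integral_pos:
  fixes f :: "'a::euclidean_space \<Rightarrow> 'b::euclidean_space"
  assumes f: "sq_int K f" and U: "open U" "U \<noteq> {}" "U \<subseteq> K" and nz: "\<And>x. x \<in> U \<Longrightarrow> f x \<noteq> 0"
  shows "0 < (LINT x:K|lebesgue. (norm (f x))\<^sup>2)"
proof -
  have "(LINT x:K|lebesgue. (norm (f x))\<^sup>2) \<noteq> 0"
  proof
    assume 0: "(LINT x:K|lebesgue. (norm (f x))\<^sup>2) = 0"
    have "AE x in lebesgue. indicat_real K x *\<^sub>R (norm (f x))\<^sup>2 = 0"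
      using 0 sq_int_norm[OF f] unfolding set_lebesgue_integral_def set_integrable_def
      by (subst (asm) integral_nonneg_eq_0_iff_AE) auto
    then have "AE x in lebesgue. x \<notin> U"
      by eventually_elim (use U nz in \<open>auto simp: indicator_def split: if_splits\<close>)
    then have "negligible U"
      using U(1) AE_iff_null_sets[of U lebesgue] by (simp add: negligible_iff_null_sets)
    then show False using open_not_negligible[OF U(1,2)] by simp
  qed
  moreover have "0 \<le> (LINT x:K|lebesgue. (norm (f x))\<^sup>2)"
    by (rule set_lebesgue_integral_nonneg) simp
  ultimately show ?thesis by simp
qed

text \<open>The nonempty element comes from the covering property: if all elements were empty, so
  would be the closure of \<Omega>.\<close>

lemma triangulationD:
  assumes "triangulation T \<Omega>"
  shows "finite T" "K \<in> T \<Longrightarrow> open K" "K \<in> T \<Longrightarrow> K \<subseteq> \<Omega>" "\<Omega> \<noteq> {} \<Longrightarrow> \<exists>K\<in>T. K \<noteq> {}"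
proof -
  have t: "finite T" "\<forall>K\<in>T. \<exists>S. open_simplex S K" "\<forall>K\<in>T. K \<subseteq> \<Omega>" "\<Union>(closure ` T) = closure \<Omega>"
    using assms unfolding triangulation_def by - (elim conjE, assumption)+
  show "finite T" "K \<in> T \<Longrightarrow> K \<subseteq> \<Omega>" using t(1,3) by auto
  show "K \<in> T \<Longrightarrow> open K" using t(2) by (auto simp: open_simplex_def)
  show "\<Omega> \<noteq> {} \<Longrightarrow> \<exists>K\<in>T. K \<noteq> {}"
  proof (rule ccontr)
    assume "\<Omega> \<noteq> {}" "\<not> (\<exists>K\<in>T. K \<noteq> {})"
    then have "\<Union>(closure ` T) = {}" by auto
    with t(4) have "closure \<Omega> = {}" by (rule trans[OF sym])
    with \<open>\<Omega> \<noteq> {}\<close> show False by simp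
  qed
qed

lemma ex_bump_in_element:
  assumes "triangulation T \<Omega>" "\<Omega> \<noteq> {}"
  obtains K c r where "K \<in> T" "r > 0" "cball c r \<subseteq> K" "cball c r \<subseteq> \<Omega>"
proof -
  obtain K where K: "K \<in> T" "K \<noteq> {}" using triangulationD(4)[OF assms] by (elim bexE)
  then obtain c where c: "c \<in> K" by auto
  have "open K" "K \<subseteq> \<Omega>" using triangulationD(2,3)[OF assms(1) K(1)] by simp_all
  moreover obtain r where "r > 0" "cball c r \<subseteq> K"
    using \<open>open K\<close> c open_contains_cball[of K] by metis
  ultimately show thesis using that[OF K(1)] by (meson order_trans)
qed

text \<open>The zero-order term on the element containing the ball is already positive; the chosen
  gradients only add something nonnegative and need not be computed.\<close>

lemma H1_D_nontrivial:
  assumes T: "triangulation T \<Omega>" and \<Omega>: "\<Omega> \<noteq> {}" "open \<Omega>" "bounded \<Omega>" and "\<epsilon> > 0"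
  shows "\<exists>w\<in>H1_D \<Omega> GD. H1_eps_norm T \<epsilon> w \<noteq> 0"
proof -
  obtain K c r where K: "K \<in> T" "r > 0" "cball c r \<subseteq> K" "cball c r \<subseteq> \<Omega>"
    using ex_bump_in_element[OF T \<Omega>(1)] .
  have opn: "open K" and sub: "K \<subseteq> \<Omega>" using triangulationD(2,3)[OF T K(1)] by simp_all
  let ?f = "bump c r"
  have "sq_int K ?f"
    by (rule sq_int_subset[OF sq_int_continuous[OF C1_continuous_on[OF C1_bump] \<Omega>(3,2)] _ sub])
       (simp add: opn borel_open)
  then have "0 < (LINT x:K|lebesgue. (norm (?f x))\<^sup>2)"
  proof (rule norm_sq_integral_pos[where U="ball c r"])
    show "ball c r \<noteq> {}" "ball c r \<subseteq> K" using K ball_subset_cball[of c r] by auto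
    show "bump c r x \<noteq> 0" if "x \<in> ball c r" for x
      using bump_pos_iff[OF K(2), of c x] that by linarith
  qed simp
  then have "0 < (\<Sum>K\<in>T. LINT x:K|lebesgue. (?f x)\<^sup>2)"
    using K(1) triangulationD(1)[OF T] by (intro sum_pos2[of T K] set_lebesgue_integral_nonneg) auto
  moreover have "0 \<le> (\<Sum>K\<in>T. LINT x:K|lebesgue. (norm (wgrad K ?f x))\<^sup>2)"
    by (intro sum_nonneg set_lebesgue_integral_nonneg) simp
  ultimately have "0 < H1_eps_norm T \<epsilon> ?f"
    using \<open>\<epsilon> > 0\<close> unfolding H1_eps_norm_def
    by (intro real_sqrt_gt_zero add_pos_nonneg mult_pos_pos mult_nonneg_nonneg) auto
  then show ?thesis
    using C1c_on_in_H1_D[OF \<Omega>(2,3) C1c_on_bump[OF K(2,4)]] by (intro bexI[of _ ?f]) auto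
qed

lemma Hdiv_N_nontrivial:
  fixes \<Omega> :: "'a::euclidean_space set"
  assumes T: "triangulation T \<Omega>" and \<Omega>: "\<Omega> \<noteq> {}" "open \<Omega>" "bounded \<Omega>" and "\<epsilon> > 0"
  shows "\<exists>w\<in>Hdiv_N \<Omega> GN. Hdiv_eps_norm T \<epsilon> w \<noteq> 0"
proof -
  obtain K c r where K: "K \<in> T" "r > 0" "cball c r \<subseteq> K" "cball c r \<subseteq> \<Omega>"
    using ex_bump_in_element[OF T \<Omega>(1)] .
  have opn: "open K" and sub: "K \<subseteq> \<Omega>" using triangulationD(2,3)[OF T K(1)] by simp_all
  \<comment> \<open>Any nonzero direction would do to turn the scalar bump into a vector
    field.\<close>
  define b where "b = (SOME b::'a. b \<in> Basis)"
  have b: "b \<noteq> 0" unfolding b_def using SOME_Basis nonzero_Basis by blast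
  let ?f = "\<lambda>x. bump c r x *\<^sub>R b"
  have C: "C1 ?f" by (intro C1_scaleR C1_bump C1_const)
  have "sq_int K ?f"
    by (rule sq_int_subset[OF sq_int_continuous[OF C1_continuous_on[OF C] \<Omega>(3,2)] _ sub])
       (simp add: opn borel_open)
  then have "0 < (LINT x:K|lebesgue. (norm (?f x))\<^sup>2)"
  proof (rule norm_sq_integral_pos[where U="ball c r"])
    show "ball c r \<noteq> {}" "ball c r \<subseteq> K" using K ball_subset_cball[of c r] by auto
    show "bump c r x *\<^sub>R b \<noteq> 0" if "x \<in> ball c r" for x
      using bump_pos_iff[OF K(2), of c x] that b by simp
  qed simp
  then have "0 < (\<Sum>K\<in>T. LINT x:K|lebesgue. (norm (?f x))\<^sup>2)"
    using K(1) triangulationD(1)[OF T] by (intro sum_pos2[of T K] set_lebesgue_integral_nonneg) auto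
  moreover have "0 \<le> (\<Sum>K\<in>T. LINT x:K|lebesgue. (wdiv K ?f x)\<^sup>2)"
    by (intro sum_nonneg set_lebesgue_integral_nonneg) simp
  ultimately have "0 < Hdiv_eps_norm T \<epsilon> ?f"
    using \<open>\<epsilon> > 0\<close> unfolding Hdiv_eps_norm_def
    by (intro real_sqrt_gt_zero add_pos_nonneg mult_pos_pos mult_nonneg_nonneg) auto
  then show ?thesis
    using C1c_on_in_Hdiv_N[OF \<Omega>(2,3) C1c_on_scaleR[OF C1c_on_bump[OF K(2,4)] C1_const]]
    by (intro bexI[of _ ?f]) auto
qed

section \<open>Bounds for the two jump norms\<close>

text \<open>Both weights are \<open>inverse \<epsilon>\<close>, which makes one Cauchy-Schwarz
  factor equal to \<open>Hdiv_eps_norm\<close>; their reciprocals put \<open>\<epsilon>\<close> on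
  both terms of the bound.\<close>

lemma jump_norm_v_le:
  assumes T: "triangulation T \<Omega>" and \<Omega>: "\<Omega> \<noteq> {}" "open \<Omega>" "bounded \<Omega>" and "\<epsilon> > 0" and v: "broken_H1 T v"
  shows "\<bar>jump_norm_v T \<Omega> GN \<epsilon> v\<bar> \<le> sqrt (\<epsilon> * (\<Sum>K\<in>T. LINT x:K|lebesgue. (v x)\<^sup>2)
      + \<epsilon> * (\<Sum>K\<in>T. LINT x:K|lebesgue. (norm (wgrad K v x))\<^sup>2))" (is "_ \<le> ?B")
  unfolding jump_norm_v_def
proof (rule cSup_abs_le)
  show "{(\<Sum>K\<in>T. bpair K w v) / Hdiv_eps_norm T \<epsilon> w |w.
      w \<in> Hdiv_N \<Omega> GN \<and> Hdiv_eps_norm T \<epsilon> w \<noteq> 0} \<noteq> {}"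
    using Hdiv_N_nontrivial[OF T \<Omega> \<open>\<epsilon> > 0\<close>, of GN] by blast
next
  fix y assume "y \<in> {(\<Sum>K\<in>T. bpair K w v) / Hdiv_eps_norm T \<epsilon> w |w.
      w \<in> Hdiv_N \<Omega> GN \<and> Hdiv_eps_norm T \<epsilon> w \<noteq> 0}"
  then obtain w where w: "Hdiv \<Omega> w" "Hdiv_eps_norm T \<epsilon> w \<noteq> 0"
    and y: "y = (\<Sum>K\<in>T. bpair K w v) / Hdiv_eps_norm T \<epsilon> w"
    by (auto simp: Hdiv_N_def)
  have Hw: "Hdiv K w" if "K \<in> T" for K
    using Hdiv_subset[OF w(1)] triangulationD(2,3)[OF T that] by auto
  have Hv: "H1 K v" if "K \<in> T" for K using v that by (simp add: broken_H1_def)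
  have "\<bar>\<Sum>K\<in>T. bpair K w v\<bar> \<le> Hdiv_eps_norm T \<epsilon> w * ?B"
    using abs_broken_pairing_le[of "inverse \<epsilon>" "inverse \<epsilon>" T "\<lambda>K. wdiv K w" "\<lambda>K. v" "\<lambda>K. w" "\<lambda>K. wgrad K v"]
      Hdiv_wdiv[OF Hw] H1_wgrad[OF Hv] \<open>\<epsilon> > 0\<close>
    by (simp add: bpair_def Hdiv_eps_norm_def add.commute)
  moreover have "0 \<le> Hdiv_eps_norm T \<epsilon> w"
    using \<open>\<epsilon> > 0\<close> unfolding Hdiv_eps_norm_def
    by (intro real_sqrt_ge_zero add_nonneg_nonneg mult_nonneg_nonneg sum_nonneg set_lebesgue_integral_nonneg) auto
  ultimately show "\<bar>y\<bar> \<le> ?B" using w(2) by (simp add: y divide_le_eq mult.commute)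
qed

text \<open>Here the weights differ, \<open>\<epsilon>\<close> on the divergence and
  \<open>inverse \<epsilon>\<close> on the field, because their reciprocals must reproduce
  \<open>H1_eps_norm\<close>.\<close>

lemma jump_norm_tau_le:
  assumes T: "triangulation T \<Omega>" and \<Omega>: "\<Omega> \<noteq> {}" "open \<Omega>" "bounded \<Omega>" and "\<epsilon> > 0" and \<tau>: "broken_Hdiv T \<tau>"
  shows "\<bar>jump_norm_tau T \<Omega> GD \<epsilon> \<tau>\<bar> \<le> sqrt (\<epsilon> * (\<Sum>K\<in>T. LINT x:K|lebesgue. (wdiv K \<tau> x)\<^sup>2)
      + inverse \<epsilon> * (\<Sum>K\<in>T. LINT x:K|lebesgue. (norm (\<tau> x))\<^sup>2))" (is "_ \<le> ?B")
  unfolding jump_norm_tau_def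
proof (rule cSup_abs_le)
  show "{(\<Sum>K\<in>T. bpair K \<tau> w) / H1_eps_norm T \<epsilon> w |w.
      w \<in> H1_D \<Omega> GD \<and> H1_eps_norm T \<epsilon> w \<noteq> 0} \<noteq> {}"
    using H1_D_nontrivial[OF T \<Omega> \<open>\<epsilon> > 0\<close>, of GD] by blast
next
  fix y assume "y \<in> {(\<Sum>K\<in>T. bpair K \<tau> w) / H1_eps_norm T \<epsilon> w |w.
      w \<in> H1_D \<Omega> GD \<and> H1_eps_norm T \<epsilon> w \<noteq> 0}"
  then obtain w where w: "H1 \<Omega> w" "H1_eps_norm T \<epsilon> w \<noteq> 0"
    and y: "y = (\<Sum>K\<in>T. bpair K \<tau> w) / H1_eps_norm T \<epsilon> w"
    by (auto simp: H1_D_def)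
  have Hw: "H1 K w" if "K \<in> T" for K
    using H1_subset[OF w(1)] triangulationD(2,3)[OF T that] by auto
  have H\<tau>: "Hdiv K \<tau>" if "K \<in> T" for K using \<tau> that by (simp add: broken_Hdiv_def)
  have "\<bar>\<Sum>K\<in>T. bpair K \<tau> w\<bar> \<le> ?B * H1_eps_norm T \<epsilon> w"
    using abs_broken_pairing_le[of \<epsilon> "inverse \<epsilon>" T "\<lambda>K. wdiv K \<tau>" "\<lambda>K. w" "\<lambda>K. \<tau>" "\<lambda>K. wgrad K w"]
      Hdiv_wdiv[OF H\<tau>] H1_wgrad[OF Hw] \<open>\<epsilon> > 0\<close>
    by (simp add: bpair_def H1_eps_norm_def)
  moreover have "0 \<le> H1_eps_norm T \<epsilon> w"
    using \<open>\<epsilon> > 0\<close> unfolding H1_eps_norm_def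
    by (intro real_sqrt_ge_zero add_nonneg_nonneg mult_nonneg_nonneg sum_nonneg set_lebesgue_integral_nonneg) auto
  ultimately show "\<bar>y\<bar> \<le> ?B" using w(2) by (simp add: y divide_le_eq mult.commute)
qed

section \<open>Control of div tau and tau by the test norm, and the final constant\<close>

lemma broken_div_sq_le:
  fixes a :: "'a::euclidean_space \<Rightarrow> 'a" and M :: real
  assumes T: "\<And>K. K \<in> T \<Longrightarrow> sq_int K (d K)" "\<And>K. K \<in> T \<Longrightarrow> sq_int K (g K)"
    and a: "\<And>K. K \<in> T \<Longrightarrow> set_borel_measurable lebesgue K a"
    and M: "\<And>K x. K \<in> T \<Longrightarrow> x \<in> K \<Longrightarrow> norm (a x) \<le> M"
  shows "(\<Sum>K\<in>T. LINT x:K|lebesgue. (d K x)\<^sup>2)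
    \<le> 2 * (\<Sum>K\<in>T. LINT x:K|lebesgue. (d K x - a x \<bullet> g K x)\<^sup>2) + 2 * M\<^sup>2 * (\<Sum>K\<in>T. LINT x:K|lebesgue. (norm (g K x))\<^sup>2)"
  unfolding sum_distrib_left sum.distrib[symmetric]
proof (rule sum_mono)
  fix K assume K: "K \<in> T"
  have ag: "sq_int K (\<lambda>x. a x \<bullet> g K x)"
    by (rule sq_int_inner_bounded[OF a[OF K] T(2)[OF K] M[OF K]])
  note I = sq_int_real[OF T(1)[OF K]] sq_int_real[OF sq_int_diff[OF T(1)[OF K] ag]] sq_int_norm[OF T(2)[OF K]]
  have "(LINT x:K|lebesgue. (d K x)\<^sup>2)
      \<le> (LINT x:K|lebesgue. 2 * (d K x - a x \<bullet> g K x)\<^sup>2 + 2 * M\<^sup>2 * (norm (g K x))\<^sup>2)"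
  proof (rule set_integral_mono)
    fix x assume x: "x \<in> K"
    have "\<bar>a x \<bullet> g K x\<bar> \<le> norm (a x) * norm (g K x)" by (rule Cauchy_Schwarz_ineq2)
    also have "\<dots> \<le> M * norm (g K x)" by (intro mult_right_mono M[OF K x]) auto
    finally have "\<bar>a x \<bullet> g K x\<bar>\<^sup>2 \<le> (M * norm (g K x))\<^sup>2" by (rule power_mono) auto
    moreover have "(d K x)\<^sup>2 \<le> 2 * (d K x - a x \<bullet> g K x)\<^sup>2 + 2 * (a x \<bullet> g K x)\<^sup>2"
      \<comment> \<open>With x = d - a . g and y = a . g this is the square of x - y; its
        nonnegativity is equivalent to (x + y)^2 \<le> 2 x^2 + 2 y^2.\<close>
      using zero_le_power2[of "d K x - 2 * (a x \<bullet> g K x)"] by (simp add: power2_eq_square algebra_simps)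
    ultimately show "(d K x)\<^sup>2 \<le> 2 * (d K x - a x \<bullet> g K x)\<^sup>2 + 2 * M\<^sup>2 * (norm (g K x))\<^sup>2"
      by (simp add: power_mult_distrib)
  qed (intro set_integral_add set_integrable_mult_right I)+
  then show "(LINT x:K|lebesgue. (d K x)\<^sup>2) \<le> 2 * (LINT x:K|lebesgue. (d K x - a x \<bullet> g K x)\<^sup>2)
      + 2 * M\<^sup>2 * (LINT x:K|lebesgue. (norm (g K x))\<^sup>2)"
    by (simp only: set_integral_add(2) set_integrable_mult_right I set_integral_mult_right)
qed

lemma broken_flux_sq_le:
  fixes t :: "'a::euclidean_space \<Rightarrow> 'a"
  assumes T: "\<And>K. K \<in> T \<Longrightarrow> sq_int K t" "\<And>K. K \<in> T \<Longrightarrow> sq_int K (g K)"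
  shows "(\<Sum>K\<in>T. LINT x:K|lebesgue. (norm (t x))\<^sup>2)
    \<le> 2 * (\<Sum>K\<in>T. LINT x:K|lebesgue. (norm (t x + c *\<^sub>R g K x))\<^sup>2) + 2 * c\<^sup>2 * (\<Sum>K\<in>T. LINT x:K|lebesgue. (norm (g K x))\<^sup>2)"
  unfolding sum_distrib_left sum.distrib[symmetric]
proof (rule sum_mono)
  fix K assume K: "K \<in> T"
  note I = sq_int_norm[OF T(1)[OF K]] sq_int_norm[OF sq_int_add[OF T(1)[OF K] sq_int_scaleR[OF T(2)[OF K]]]]
    sq_int_norm[OF T(2)[OF K]]
  have "(LINT x:K|lebesgue. (norm (t x))\<^sup>2)
      \<le> (LINT x:K|lebesgue. 2 * (norm (t x + c *\<^sub>R g K x))\<^sup>2 + 2 * c\<^sup>2 * (norm (g K x))\<^sup>2)"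
  proof (rule set_integral_mono)
    fix x
    \<comment> \<open>The vector is the sum of t + c g and c g, whose difference is t; a nonnegative
      squared norm of the sum bounds that of the difference.\<close>
    have "0 \<le> (norm (t x + (2 * c) *\<^sub>R g K x))\<^sup>2" by simp
    then show "(norm (t x))\<^sup>2 \<le> 2 * (norm (t x + c *\<^sub>R g K x))\<^sup>2 + 2 * c\<^sup>2 * (norm (g K x))\<^sup>2"
      unfolding power2_norm_eq_inner
      by (simp add: inner_add_left inner_add_right inner_commute power2_eq_square algebra_simps)
  qed (intro set_integral_add set_integrable_mult_right I)+
  then show "(LINT x:K|lebesgue. (norm (t x))\<^sup>2) \<le> 2 * (LINT x:K|lebesgue. (norm (t x + c *\<^sub>R g K x))\<^sup>2)
      + 2 * c\<^sup>2 * (LINT x:K|lebesgue. (norm (g K x))\<^sup>2)"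
    by (simp only: set_integral_add(2) set_integrable_mult_right I set_integral_mult_right)
qed

text \<open>A real supremum is an upper bound only for a set bounded above; boundedness comes from
  continuity on the compact closure.\<close>

lemma norm_le_Linf_norm:
  assumes "bounded \<Omega>" "continuous_on (closure \<Omega>) a" "x \<in> \<Omega>"
  shows "norm (a x) \<le> Linf_norm \<Omega> a"
  unfolding Linf_norm_def
proof (rule cSUP_upper[OF assms(3)])
  have "bounded (a ` closure \<Omega>)"
    using assms by (intro compact_imp_bounded compact_continuous_image) auto
  then obtain B where "\<And>x. x \<in> closure \<Omega> \<Longrightarrow> norm (a x) \<le> B" by (auto simp: bounded_iff)
  then show "bdd_above ((\<lambda>x. norm (a x)) ` \<Omega>)"
    using closure_subset[of \<Omega>] by (intro bdd_aboveI2[of _ _ B]) auto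
qed

lemma continuous_on_open_set_borel_measurable:
  fixes a :: "'a::euclidean_space \<Rightarrow> 'b::euclidean_space"
  assumes "continuous_on K a" "open K"
  shows "set_borel_measurable lebesgue K a"
  using borel_measurable_continuous_on_indicator[of K a] assms
  by (simp add: set_borel_measurable_def measurable_completion)

theorem mainTheorem2:
  fixes \<Omega> GD GN :: "'a::euclidean_space set" and T :: "'a set set" and \<epsilon> :: real
    and a :: "'a \<Rightarrow> 'a" and v :: "'a \<Rightarrow> real" and \<tau> :: "'a \<Rightarrow> 'a"
  assumes "polyhedral_domain \<Omega>"
    and "boundary_partition \<Omega> GD GN"
    and "triangulation T \<Omega>"
    and "\<epsilon> > 0"
    and "continuous_on (closure \<Omega>) a"
    and "broken_H1 T v"
    and "broken_Hdiv T \<tau>"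
  shows "V_opt_norm T \<Omega> GD GN \<epsilon> a v \<tau> \<le> sqrt (3 + 2 * (Linf_norm \<Omega> a)^2) * V_norm T \<epsilon> a v \<tau>"
proof -
  have \<Omega>: "\<Omega> \<noteq> {}" "open \<Omega>" "bounded \<Omega>" using assms(1) by (auto simp: polyhedral_domain_def)
  define M where "M = Linf_norm \<Omega> a"
  define A where "A = (\<Sum>K\<in>T. LINT x:K|lebesgue. (wdiv K \<tau> x - a x \<bullet> wgrad K v x)\<^sup>2)"
  define B where "B = (\<Sum>K\<in>T. LINT x:K|lebesgue. (norm (\<tau> x + \<epsilon> *\<^sub>R wgrad K v x))\<^sup>2)"
  define C where "C = (\<Sum>K\<in>T. LINT x:K|lebesgue. (v x)\<^sup>2)"
  define G where "G = (\<Sum>K\<in>T. LINT x:K|lebesgue. (norm (wgrad K v x))\<^sup>2)"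
  define D where "D = (\<Sum>K\<in>T. LINT x:K|lebesgue. (wdiv K \<tau> x)\<^sup>2)"
  define E where "E = (\<Sum>K\<in>T. LINT x:K|lebesgue. (norm (\<tau> x))\<^sup>2)"
  define Jv where "Jv = jump_norm_v T \<Omega> GN \<epsilon> v"
  define J\<tau> where "J\<tau> = jump_norm_tau T \<Omega> GD \<epsilon> \<tau>"
  have nonneg: "0 \<le> A" "0 \<le> B" "0 \<le> C" "0 \<le> G" "0 \<le> D" "0 \<le> E"
    unfolding A_def B_def C_def G_def D_def E_def
    by (intro sum_nonneg set_lebesgue_integral_nonneg; simp)+
  have Hv: "H1 K v" and H\<tau>: "Hdiv K \<tau>" if "K \<in> T" for K
    using assms(6,7) that by (auto simp: broken_H1_def broken_Hdiv_def)
  have am: "set_borel_measurable lebesgue K a" if "K \<in> T" for K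
    using triangulationD(2,3)[OF assms(3) that] closure_subset[of \<Omega>]
    by (intro continuous_on_open_set_borel_measurable continuous_on_subset[OF assms(5)]) auto
  have aM: "norm (a x) \<le> M" if "K \<in> T" "x \<in> K" for K x
    using norm_le_Linf_norm[OF \<Omega>(3) assms(5)] triangulationD(3)[OF assms(3)] that by (auto simp: M_def)
  have D: "D \<le> 2 * A + 2 * M\<^sup>2 * G"
    unfolding D_def A_def G_def by (rule broken_div_sq_le[OF Hdiv_wdiv(2)[OF H\<tau>] H1_wgrad(2)[OF Hv] am aM])
  have E: "E \<le> 2 * B + 2 * \<epsilon>\<^sup>2 * G"
    unfolding E_def B_def G_def by (rule broken_flux_sq_le[OF Hdiv_wdiv(1)[OF H\<tau>] H1_wgrad(2)[OF Hv]])
  have "\<bar>Jv\<bar>\<^sup>2 \<le> (sqrt (\<epsilon> * C + \<epsilon> * G))\<^sup>2"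
    using jump_norm_v_le[OF assms(3) \<Omega> assms(4,6), of GN] by (intro power_mono) (auto simp: Jv_def C_def G_def)
  then have Jv: "Jv\<^sup>2 \<le> \<epsilon> * C + \<epsilon> * G" using nonneg assms(4) by simp
  have "\<bar>J\<tau>\<bar>\<^sup>2 \<le> (sqrt (\<epsilon> * D + inverse \<epsilon> * E))\<^sup>2"
    using jump_norm_tau_le[OF assms(3) \<Omega> assms(4,7), of GD] by (intro power_mono) (auto simp: J\<tau>_def D_def E_def)
  then have "J\<tau>\<^sup>2 \<le> \<epsilon> * D + inverse \<epsilon> * E" using nonneg assms(4) by simp
  also have "\<dots> \<le> \<epsilon> * (2 * A + 2 * M\<^sup>2 * G) + inverse \<epsilon> * (2 * B + 2 * \<epsilon>\<^sup>2 * G)"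
    using D E assms(4) by (intro add_mono mult_left_mono) auto
  also have "\<dots> = 2 * (\<epsilon> * A) + 2 * M\<^sup>2 * (\<epsilon> * G) + 2 * (inverse \<epsilon> * B) + 2 * (\<epsilon> * G)"
    using assms(4) by (simp add: field_simps power2_eq_square)
  finally have J\<tau>: "J\<tau>\<^sup>2 \<le> \<dots>" .
  \<comment> \<open>The four summands of the squared \<open>V_norm\<close>, weights included, as
    atoms for the linear arithmetic.\<close>
  define p q s u where "p = \<epsilon> * A" "q = inverse \<epsilon> * B" "s = \<epsilon> * C" "u = \<epsilon> * G"
  have pq: "0 \<le> p" "0 \<le> q" "0 \<le> s" "0 \<le> u" using nonneg assms(4) by (auto simp: p_q_s_u_def)
  \<comment> \<open>The coefficients 3 of \<open>p\<close> and \<open>q\<close> are the 1 already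
    present in \<open>V_opt_norm\<close> plus the 2 from splitting div tau and tau. The coefficient
    of \<open>u\<close> is the largest of the four and replaces the others.\<close>
  have "p + q + Jv\<^sup>2 + J\<tau>\<^sup>2 \<le> 3 * p + 3 * q + s + (3 + 2 * M\<^sup>2) * u"
    using Jv J\<tau> by (simp add: p_q_s_u_def algebra_simps)
  also have "\<dots> \<le> (3 + 2 * M\<^sup>2) * p + (3 + 2 * M\<^sup>2) * q + (3 + 2 * M\<^sup>2) * s + (3 + 2 * M\<^sup>2) * u"
    using mult_right_mono[of 3 "3 + 2 * M\<^sup>2" p] mult_right_mono[of 3 "3 + 2 * M\<^sup>2" q]
      mult_right_mono[of 1 "3 + 2 * M\<^sup>2" s] pq zero_le_power2[of M] by linarith
  also have "\<dots> = (3 + 2 * M\<^sup>2) * (p + q + s + u)" by (simp add: algebra_simps)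
  finally have "sqrt (p + q + Jv\<^sup>2 + J\<tau>\<^sup>2) \<le> sqrt (3 + 2 * M\<^sup>2) * sqrt (p + q + s + u)"
    by (simp flip: real_sqrt_mult)
  then show ?thesis
    by (simp add: V_opt_norm_def V_norm_def M_def A_def B_def C_def G_def Jv_def J\<tau>_def p_q_s_u_def)
qed

end
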